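(* Let $S$ be a finite-dimensional quantum system with algebra $M_d(\mathbb{C})$ and let $\{\Lambda_t\}_{t\ge0}$ be a P-divisible family of completely positive trace-preserving maps on $M_d(\mathbb{C})$, with positive trace-preserving intertwiners $\Lambda_{t,s}$. Let $\rho_{S+S},\sigma_{S+S}$ be density matrices on $\mathbb{C}^d\otimes\mathbb{C}^d$, let $\mu\in[0,1]$, and put $\Delta_\mu(\rho_{S+S},\sigma_{S+S})=\mu\,\rho_{S+S}-(1-\mu)\,\sigma_{S+S}$, $\rho_{S+S}(t)=\Lambda_t\otimes\Lambda_t[\rho_{S+S}]$, $\sigma_{S+S}(t)=\Lambda_t\otimes\Lambda_t[\sigma_{S+S}]$. Then, for all $t,\tau>0$, the variation of the Helstrom distinguishability $$\Delta D_\mu(t+\tau,t):=\big\|\Lambda_{t+\tau}\otimes\Lambda_{t+\tau}[\Delta_\mu(\rho_{S+S},\sigma_{S+S})]\big\|_1-\big\|\Lambda_t\otimes\Lambda_t[\Delta_\mu(\rho_{S+S},\sigma_{S+S})]\big\|_1$$ satisfies $$\Delta D_\mu(t+\tau,t)\le2\,\|\Lambda_{t+\tau,t}\|_\diamond^2\;\mathcal{Q}_{\{\mathbb{P}^1\otimes\mathbb{P}^2\}}\big(\chi^{\mathcal{E}_H}(t)\big),$$ where $\chi^{\mathcal{E}_H}(t)=\mu\,\rho_{S+S}(t)\otimes|0\rangle\langle0|+(1-\mu)\,\sigma_{S+S}(t)\otimes|1\rangle\langle1|$ encodes the Helstrom ensemble $\mathcal{E}_H(t)=\{(\mu;\rh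o_{S+S}(t)),(1-\mu;\sigma_{S+S}(t))\}$.
   Context: $\|X\|_1=\mathrm{Tr}\sqrt{X^\dagger X}$ is the trace norm and $D(\rho,\sigma)=\tfrac12\|\rho-\sigma\|_1$ the trace distance. The family $\{\Lambda_t\}_{t\ge0}$ is P-divisible if for all $t\ge s\ge0$ there is a positive trace-preserving map $\Lambda_{t,s}$ with $\Lambda_t=\Lambda_{t,s}\circ\Lambda_s$. The diamond norm of a linear map $\Lambda$ on $M_d(\mathbb{C})$ is $\|\Lambda\|_\diamond=\max\{\|(\Lambda\otimes\mathrm{id}_d)[X]\|_1:\|X\|_1\le1\}$. A rank-one projective measurement map is $\mathbb{P}[X]=\sum_iP_iXP_i$ with $P_i=|i\rangle\langle i|$ for an orthonormal basis $\{|i\rangle\}$. For an ensemble $\mathcal{E}=\{(\mu_i,\rho_i)\}$ of bipartite states, encoded as $\chi^{\mathcal{E}}=\sum_i\mu_i\rho_i\otimes|i\rangle\langle i|$, the ensemble quantumness of correlations is $$\mathcal{Q}_{\{\mathbb{P}^1\otimes\mathbb{P}^2\}}(\chi^{\mathcal{E}})=\min_{\mathbb{P}^1\otimes\mathbb{P}^2}\sum_i\mu_i\,D\big(\rho_i,\;\mathbb{P}^1\otimes\mathbb{P}^2[\rho_i]\big),$$ the minimum being over pairs of rank-one projective measurement maps $\mathbb{P}^1,\mathbb{P}^2$ on the first and second party, respectively. *)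

theory Defs
  imports Complex_Main "Jordan_Normal_Form.Schur_Decomposition"
begin

abbreviation square_mats :: "nat \<Rightarrow> complex mat set" where
  "square_mats n \<equiv> carrier_mat n n"

definition mat_trace :: "complex mat \<Rightarrow> complex" where
  "mat_trace A = (\<Sum>i<dim_row A. A $$ (i, i))"

definition mat_sum :: "nat \<Rightarrow> ('i \<Rightarrow> complex mat) \<Rightarrow> 'i set \<Rightarrow> complex mat" where
  "mat_sum n F I = mat n n (\<lambda>(r, c). \<Sum>i\<in>I. F i $$ (r, c))"

(* For v in C^n this is |v><v|. *)
definition ket_bra :: "complex vec \<Rightarrow> complex mat" where
  "ket_bra v = mat (dim_vec v) (dim_vec v) (\<lambda>(r, c). v $ r * cnj (v $ c))"

(* In the order on complex, 0 <= z means that z is real and nonnegative; over the complex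
   numbers the condition below therefore forces A to be Hermitian. *)
definition psd :: "nat \<Rightarrow> complex mat \<Rightarrow> bool" where
  "psd n A \<longleftrightarrow> A \<in> square_mats n \<and> (\<forall>v\<in>carrier_vec n. 0 \<le> (A *\<^sub>v v) \<bullet>c v)"

definition density :: "nat \<Rightarrow> complex mat \<Rightarrow> bool" where
  "density n A \<longleftrightarrow> psd n A \<and> mat_trace A = 1"

definition psd_sqrt :: "complex mat \<Rightarrow> complex mat" where
  "psd_sqrt A = (THE B. psd (dim_row A) B \<and> B * B = A)"

definition trace_norm :: "complex mat \<Rightarrow> real" where
  "trace_norm X = Re (mat_trace (psd_sqrt (mat_adjoint X * X)))"

definition trace_distance :: "complex mat \<Rightarrow> complex mat \<Rightarrow> real" where
  "trace_distance A B = trace_norm (A - B) / 2"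

(* The basis vector e_i (x) f_k of C^m (x) C^n = C^(m * n) has index i * n + k. *)
definition kron :: "complex mat \<Rightarrow> complex mat \<Rightarrow> complex mat" where
  "kron A B = mat (dim_row A * dim_row B) (dim_col A * dim_col B)
     (\<lambda>(r, c). A $$ (r div dim_row B, c div dim_col B) * B $$ (r mod dim_row B, c mod dim_col B))"

definition mat_unit :: "nat \<Rightarrow> nat \<Rightarrow> nat \<Rightarrow> complex mat" where
  "mat_unit n i j = mat n n (\<lambda>(r, c). if r = i \<and> c = j then 1 else 0)"

(* The map Phi (x) Psi for linear Phi on M_m and Psi on M_n, applied to the expansion
   X = sum_{ijkl} X_{(i,k),(j,l)} E_ij (x) E_kl in matrix units. *)
definition map_tensor :: "nat \<Rightarrow> nat \<Rightarrow> (complex mat \<Rightarrow> complex mat) \<Rightarrow> (complex mat \<Rightarrow> complex mat)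
    \<Rightarrow> complex mat \<Rightarrow> complex mat" where
  "map_tensor m n \<Phi> \<Psi> X = mat (m * n) (m * n) (\<lambda>(r, c).
     \<Sum>i<m. \<Sum>j<m. \<Sum>k<n. \<Sum>l<n.
       X $$ (i * n + k, j * n + l) * kron (\<Phi> (mat_unit m i j)) (\<Psi> (mat_unit n k l)) $$ (r, c))"

(* Maps on M_d are total functions on matrices of all sizes; every notion below looks only at
   their restriction to M_d. *)
definition linear_map :: "nat \<Rightarrow> (complex mat \<Rightarrow> complex mat) \<Rightarrow> bool" where
  "linear_map d \<Phi> \<longleftrightarrow>
     (\<forall>X\<in>square_mats d. \<Phi> X \<in> square_mats d) \<and>
     (\<forall>X\<in>square_mats d. \<forall>Y\<in>square_mats d. \<Phi> (X + Y) = \<Phi> X + \<Phi> Y) \<and>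
     (\<forall>a. \<forall>X\<in>square_mats d. \<Phi> (a \<cdot>\<^sub>m X) = a \<cdot>\<^sub>m \<Phi> X)"

definition positive_map :: "nat \<Rightarrow> (complex mat \<Rightarrow> complex mat) \<Rightarrow> bool" where
  "positive_map d \<Phi> \<longleftrightarrow> linear_map d \<Phi> \<and> (\<forall>X. psd d X \<longrightarrow> psd d (\<Phi> X))"

definition trace_preserving :: "nat \<Rightarrow> (complex mat \<Rightarrow> complex mat) \<Rightarrow> bool" where
  "trace_preserving d \<Phi> \<longleftrightarrow> (\<forall>X\<in>square_mats d. mat_trace (\<Phi> X) = mat_trace X)"

definition completely_positive :: "nat \<Rightarrow> (complex mat \<Rightarrow> complex mat) \<Rightarrow> bool" where
  "completely_positive d \<Phi> \<longleftrightarrow>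
     linear_map d \<Phi> \<and> (\<forall>k. positive_map (d * k) (map_tensor d k \<Phi> id))"

definition cptp :: "nat \<Rightarrow> (complex mat \<Rightarrow> complex mat) \<Rightarrow> bool" where
  "cptp d \<Phi> \<longleftrightarrow> completely_positive d \<Phi> \<and> trace_preserving d \<Phi>"

(* V t s is the intertwiner taking time s to time t. *)
definition P_divisible_with :: "nat \<Rightarrow> (real \<Rightarrow> complex mat \<Rightarrow> complex mat)
    \<Rightarrow> (real \<Rightarrow> real \<Rightarrow> complex mat \<Rightarrow> complex mat) \<Rightarrow> bool" where
  "P_divisible_with d \<Lambda> V \<longleftrightarrow> (\<forall>t s. 0 \<le> s \<and> s \<le> t \<longrightarrow>
     positive_map d (V t s) \<and> trace_preserving d (V t s) \<and>
     (\<forall>X\<in>square_mats d. \<Lambda> t X = V t s (\<Lambda> s X)))"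

(* For a linear map the set is nonempty, bounded and compact, so Sup is the maximum. *)
definition diamond_norm :: "nat \<Rightarrow> (complex mat \<Rightarrow> complex mat) \<Rightarrow> real" where
  "diamond_norm d \<Phi> =
     Sup {trace_norm (map_tensor d d \<Phi> id X) | X. X \<in> square_mats (d * d) \<and> trace_norm X \<le> 1}"

definition orthonormal_basis :: "nat \<Rightarrow> (nat \<Rightarrow> complex vec) \<Rightarrow> bool" where
  "orthonormal_basis d b \<longleftrightarrow>
     (\<forall>i<d. b i \<in> carrier_vec d) \<and> (\<forall>i<d. \<forall>j<d. b i \<bullet>c b j = (if i = j then 1 else 0))"

definition rank_one_measurement :: "nat \<Rightarrow> (complex mat \<Rightarrow> complex mat) \<Rightarrow> bool" where
  "rank_one_measurement d P \<longleftrightarrow> (\<exists>b. orthonormal_basis d b \<and>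
     P = (\<lambda>X. mat_sum d (\<lambda>i. ket_bra (b i) * X * ket_bra (b i)) {..<d}))"

definition ensemble :: "nat \<Rightarrow> (real \<times> complex mat) list \<Rightarrow> bool" where
  "ensemble n E \<longleftrightarrow>
     (\<forall>(p, A)\<in>set E. 0 \<le> p \<and> density n A) \<and> (\<Sum>i<length E. fst (E ! i)) = 1"

definition encode :: "nat \<Rightarrow> (real \<times> complex mat) list \<Rightarrow> complex mat" where
  "encode n E = mat_sum (n * length E)
     (\<lambda>i. complex_of_real (fst (E ! i)) \<cdot>\<^sub>m kron (snd (E ! i)) (ket_bra (unit_vec (length E) i)))
     {..<length E}"

(* The infimum is over a nonempty compact set of real numbers, hence is a minimum. *)
definition min_disturbance :: "nat \<Rightarrow> nat \<Rightarrow> (real \<times> complex mat) list \<Rightarrow> real" where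
  "min_disturbance d1 d2 E =
     Inf {\<Sum>i<length E. fst (E ! i) *
            trace_distance (snd (E ! i)) (map_tensor d1 d2 P1 P2 (snd (E ! i))) | P1 P2.
          rank_one_measurement d1 P1 \<and> rank_one_measurement d2 P2}"

(* A function of the encoding chi of an ensemble of states on C^d1 (x) C^d2. The value does not
   depend on the ensemble E encoded by chi: see ensemble_quantumness_encode. *)
definition ensemble_quantumness :: "nat \<Rightarrow> nat \<Rightarrow> complex mat \<Rightarrow> real" where
  "ensemble_quantumness d1 d2 \<chi> =
     (THE q. \<exists>E. ensemble (d1 * d2) E \<and> encode (d1 * d2) E = \<chi> \<and> q = min_disturbance d1 d2 E)"

lemma encode_block:
  assumes E: "\<forall>(p, A)\<in>set E. 0 \<le> p \<and> density n A" and i: "i < length E" and r: "r < n" and c: "c < n"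
  shows "encode n E $$ (r * length E + i, c * length E + i)
       = complex_of_real (fst (E ! i)) * snd (E ! i) $$ (r, c)"
proof -
  let ?m = "length E"
  have lt: "x * ?m + i < n * ?m" if "x < n" for x
  proof -
    have "x * ?m + i < (x + 1) * ?m" using i by simp
    also have "\<dots> \<le> n * ?m" using that by (intro mult_right_mono) auto
    finally show ?thesis .
  qed
  have dm: "snd (E ! j) \<in> square_mats n" if "j < ?m" for j
    using E nth_mem[OF that] by (auto simp: density_def psd_def)
  have "encode n E $$ (r * ?m + i, c * ?m + i)
      = (\<Sum>j<?m. (complex_of_real (fst (E ! j)) \<cdot>\<^sub>m
            kron (snd (E ! j)) (ket_bra (unit_vec ?m j))) $$ (r * ?m + i, c * ?m + i))"
    using lt[OF r] lt[OF c] by (simp add: encode_def mat_sum_def)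
  also have "\<dots> = (\<Sum>j<?m. if j = i then complex_of_real (fst (E ! i)) * snd (E ! i) $$ (r, c) else 0)"
  proof (rule sum.cong)
    fix j assume "j \<in> {..<?m}"
    hence "dim_row (snd (E ! j)) = n" "dim_col (snd (E ! j)) = n" "j < ?m" using dm[of j] by auto
    moreover have "(x * ?m + i) div ?m = x" "(x * ?m + i) mod ?m = i" for x
      using i by (auto simp: div_mult_self3[OF gr_implies_not0[OF i]])
    ultimately show "(complex_of_real (fst (E ! j)) \<cdot>\<^sub>m kron (snd (E ! j)) (ket_bra (unit_vec ?m j)))
             $$ (r * ?m + i, c * ?m + i)
        = (if j = i then complex_of_real (fst (E ! i)) * snd (E ! i) $$ (r, c) else 0)"
      using lt[OF r] lt[OF c] i by (simp add: kron_def ket_bra_def)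
  qed simp
  also have "\<dots> = complex_of_real (fst (E ! i)) * snd (E ! i) $$ (r, c)"
    using i by simp
  finally show ?thesis .
qed

lemma min_disturbance_cong:
  assumes E: "ensemble (d1 * d2) E" and F: "ensemble (d1 * d2) F"
    and eq: "encode (d1 * d2) E = encode (d1 * d2) F"
  shows "min_disturbance d1 d2 E = min_disturbance d1 d2 F"
proof -
  let ?n = "d1 * d2"
  have EE: "\<forall>(p, A)\<in>set E. 0 \<le> p \<and> density ?n A" and FF: "\<forall>(p, A)\<in>set F. 0 \<le> p \<and> density ?n A"
    using E F by (auto simp: ensemble_def)
  have "E \<noteq> []" using E by (auto simp: ensemble_def)
  hence "density ?n (snd (hd E))" using EE by (cases E) auto
  hence n: "?n > 0"
    unfolding density_def psd_def mat_trace_def by (intro gr0I) auto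
  have "?n * length E = ?n * length F"
    using arg_cong[OF eq, of dim_row] by (simp add: encode_def mat_sum_def)
  with n have len: "length E = length F" by auto
  have entry: "complex_of_real (fst (E ! i)) * snd (E ! i) $$ (r, c)
             = complex_of_real (fst (F ! i)) * snd (F ! i) $$ (r, c)"
    if "i < length E" "r < ?n" "c < ?n" for i r c
    using encode_block[OF EE that] encode_block[OF FF, of i r c] that len eq by simp
  have dE: "density ?n (snd (E ! i))" and dF: "density ?n (snd (F ! i))" if "i < length E" for i
    using EE FF nth_mem[of i E] nth_mem[of i F] that len by (auto simp: split_beta)
  have fst_eq: "fst (E ! i) = fst (F ! i)" if i: "i < length E" for i
  proof -
    have tr: "(\<Sum>r<?n. snd (E ! i) $$ (r, r)) = 1" "(\<Sum>r<?n. snd (F ! i) $$ (r, r)) = 1"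
      using dE[OF i] dF[OF i] by (auto simp: density_def psd_def mat_trace_def)
    have "(\<Sum>r<?n. complex_of_real (fst (E ! i)) * snd (E ! i) $$ (r, r))
        = (\<Sum>r<?n. complex_of_real (fst (F ! i)) * snd (F ! i) $$ (r, r))"
      using entry[OF i] by (intro sum.cong) auto
    thus ?thesis by (simp add: sum_distrib_left[symmetric] tr)
  qed
  have snd_eq: "snd (E ! i) = snd (F ! i)" if i: "i < length E" and nz: "fst (E ! i) \<noteq> 0" for i
  proof (rule eq_matI)
    have dims: "snd (E ! i) \<in> square_mats ?n" "snd (F ! i) \<in> square_mats ?n"
      using dE[OF i] dF[OF i] by (auto simp: density_def psd_def)
    thus "dim_row (snd (E ! i)) = dim_row (snd (F ! i))"
      "dim_col (snd (E ! i)) = dim_col (snd (F ! i))" by auto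
    fix r c assume "r < dim_row (snd (F ! i))" "c < dim_col (snd (F ! i))"
    thus "snd (E ! i) $$ (r, c) = snd (F ! i) $$ (r, c)"
      using entry[OF i, of r c] fst_eq[OF i] nz dims by auto
  qed
  have "(\<Sum>i<length E. fst (E ! i) *
            trace_distance (snd (E ! i)) (map_tensor d1 d2 P1 P2 (snd (E ! i))))
      = (\<Sum>i<length F. fst (F ! i) *
            trace_distance (snd (F ! i)) (map_tensor d1 d2 P1 P2 (snd (F ! i))))" for P1 P2
    unfolding len[symmetric]
  proof (rule sum.cong[OF refl])
    fix i assume "i \<in> {..<length E}"
    thus "fst (E ! i) * trace_distance (snd (E ! i)) (map_tensor d1 d2 P1 P2 (snd (E ! i)))
        = fst (F ! i) * trace_distance (snd (F ! i)) (map_tensor d1 d2 P1 P2 (snd (F ! i)))"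
      using fst_eq[of i] snd_eq[of i] by (cases "fst (E ! i) = 0") auto
  qed
  thus ?thesis by (simp add: min_disturbance_def)
qed

lemma ensemble_quantumness_encode:
  assumes "ensemble (d1 * d2) E"
  shows "ensemble_quantumness d1 d2 (encode (d1 * d2) E) = min_disturbance d1 d2 E"
  unfolding ensemble_quantumness_def
  using assms min_disturbance_cong by (intro the_equality) blast+

lemma encode_pair:
  assumes "A \<in> square_mats n" "B \<in> square_mats n"
  shows "encode n [(p, A), (q, B)]
       = complex_of_real p \<cdot>\<^sub>m kron A (ket_bra (unit_vec 2 0))
       + complex_of_real q \<cdot>\<^sub>m kron B (ket_bra (unit_vec 2 1))"
  using assms
  by (intro eq_matI) (auto simp: encode_def mat_sum_def kron_def ket_bra_def numeral_2_eq_2)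

end

theory Submission
  imports Defs "HOL-Analysis.L2_Norm" "Jordan_Normal_Form.Spectral_Radius"
begin

text \<open>Write \<open>W\<close> for the intertwiner from \<open>t\<close> to \<open>t + \<tau>\<close>, \<open>X\<close> for the Helstrom operator at time
  \<open>t\<close> and \<open>P\<close> for a product of two rank-one measurements. Then
  \<open>\<parallel>(W \<otimes> W) X\<parallel> \<le> \<parallel>(W \<otimes> W) (X - P X)\<parallel> + \<parallel>(W \<otimes> W) (P X)\<parallel>\<close>. On the first term \<open>W \<otimes> W\<close> is the product of
  \<open>W \<otimes> id\<close> and \<open>id \<otimes> W\<close>, each of norm at most \<open>\<parallel>W\<parallel>\<^sub>\<diamond>\<close>. In the second term \<open>P X\<close> is diagonal in a
  product basis, so that \<open>W \<otimes> W\<close>, although merely positive on each factor, does not increase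
  its norm, which is at most \<open>\<parallel>X\<parallel>\<close>. It remains to minimise over \<open>P\<close>. The trace norm is handled
  through its dual form, the maximum of \<open>|tr (C X)|\<close> over contractions \<open>C\<close>.\<close>

subsection \<open>Adjoints, unitary matrices and the spectral theorem\<close>

text \<open>\<open>W\<close> is only positive, so \<open>W \<otimes> W\<close> need not be positive
  and can enlarge the trace norm of an operator; for a completely positive intertwiner the variation
  could never exceed 0. The diamond norm enters squared because each tensor factor costs it once,
  and the constant 2 undoes the 1/2 in the trace distance. The weights of the ensemble appear when
  the triangle inequality separates the two states in \<open>X - P X\<close>, with |\<mu> - 1| = 1 -
  \<mu>. Two definitions shape the groundwork. \<open>psd_sqrt\<close> is a definite description, so
  the trace norm has a computable value only once positive square roots are known to be unique, and
  this rests on diagonalisation. \<open>diamond_norm\<close> is a supremum with the ancilla on the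
  right: it bounds its members only after boundedness is shown, and a map on the second factor has
  to be carried across by a flip.\<close>

lemma dim_mat_adjoint [simp]:
  "dim_row (mat_adjoint A) = dim_col A" "dim_col (mat_adjoint A) = dim_row A"
  by (auto simp: mat_adjoint_def)

lemma mat_adjoint_carrier [simp]: "A \<in> carrier_mat n m \<Longrightarrow> mat_adjoint A \<in> carrier_mat m n"
  by auto

lemma index_mat_adjoint [simp]:
  "i < dim_col A \<Longrightarrow> j < dim_row A \<Longrightarrow> mat_adjoint A $$ (i, j) = cnj (A $$ (j, i))"
  by (simp add: mat_adjoint_def mat_of_rows_index)

lemma index_mult_mat_sum:
  assumes "i < dim_row A" "j < dim_col B" "dim_col A = dim_row B"
  shows "(A * B) $$ (i, j) = (\<Sum>k<dim_row B. A $$ (i, k) * B $$ (k, j))"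
  using assms by (simp add: scalar_prod_def atLeast0LessThan)

lemma index_mult_mat_vec_sum:
  assumes "i < dim_row A" "dim_col A = dim_vec v"
  shows "(A *\<^sub>v v) $ i = (\<Sum>k<dim_vec v. A $$ (i, k) * v $ k)"
  using assms by (simp add: scalar_prod_def atLeast0LessThan)

lemma cscalar_prod_sum: "x \<bullet>c y = (\<Sum>i<dim_vec y. x $ i * cnj (y $ i))"
  by (simp add: scalar_prod_def atLeast0LessThan)

lemma mult_unit_vec:
  fixes A :: "complex mat"
  assumes "A \<in> carrier_mat m n" "j < n"
  shows "A *\<^sub>v unit_vec n j = col A j"
  using assms
  by (intro eq_vecI)
    (auto simp: index_mult_mat_vec_sum if_distrib[of "\<lambda>x. _ * x"] cong: if_cong simp del: index_mult_mat_vec)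

text \<open>The side conditions are equations between dimensions and leave no intermediate size to
  instantiate, so the simplifier can reassociate long products unaided.\<close>

lemma mult_assoc_dim:
  fixes A :: "complex mat"
  assumes "dim_col A = dim_row B" "dim_col B = dim_row C"
  shows "A * B * C = A * (B * C)"
  using assms by (intro assoc_mult_mat[of _ "dim_row A" "dim_row B" _ "dim_row C" _ "dim_col C"]) auto

lemma one_mult_dim: "dim_row A = n \<Longrightarrow> 1\<^sub>m n * A = (A :: complex mat)"
  by auto

lemma mult_one_dim: "dim_col A = n \<Longrightarrow> A * 1\<^sub>m n = (A :: complex mat)"
  by auto

lemma mat_adjoint_mult:
  assumes "dim_col A = dim_row B"
  shows "mat_adjoint (A * B) = mat_adjoint B * mat_adjoint (A :: complex mat)"
  using assms
  by (intro eq_matI) (auto simp: index_mult_mat_sum mult.commute simp del: index_mult_mat(1))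

lemma mat_adjoint_adjoint [simp]: "mat_adjoint (mat_adjoint A) = (A :: complex mat)"
  by (intro eq_matI) auto

lemma mat_adjoint_one [simp]: "mat_adjoint (1\<^sub>m n) = (1\<^sub>m n :: complex mat)"
  by (intro eq_matI) auto

lemma dim_mat_diag [simp]: "dim_row (mat_diag n f) = n" "dim_col (mat_diag n f) = n"
  by (auto simp: mat_diag_def)

lemma index_mat_diag [simp]:
  "i < n \<Longrightarrow> j < n \<Longrightarrow> mat_diag n f $$ (i, j) = (if i = j then f j else 0)"
  by (auto simp: mat_diag_def)

lemma mat_adjoint_diag: "mat_adjoint (mat_diag n f) = mat_diag n (\<lambda>i. cnj (f i))"
  by (intro eq_matI) auto

lemma cscalar_prod_adjoint:
  fixes A :: "complex mat"
  assumes "A \<in> carrier_mat m n" "x \<in> carrier_vec n" "y \<in> carrier_vec m"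
  shows "(A *\<^sub>v x) \<bullet>c y = x \<bullet>c (mat_adjoint A *\<^sub>v y)"
proof -
  have "(A *\<^sub>v x) \<bullet>c y = (\<Sum>i<m. \<Sum>k<n. A $$ (i, k) * x $ k * cnj (y $ i))"
    using assms by (auto simp: cscalar_prod_sum index_mult_mat_vec_sum sum_distrib_right
        simp del: index_mult_mat_vec)
  also have "\<dots> = (\<Sum>k<n. \<Sum>i<m. A $$ (i, k) * x $ k * cnj (y $ i))"
    by (rule sum.swap)
  also have "\<dots> = x \<bullet>c (mat_adjoint A *\<^sub>v y)"
    using assms by (auto simp: cscalar_prod_sum index_mult_mat_vec_sum sum_distrib_left mult_ac
        simp del: index_mult_mat_vec intro!: sum.cong)
  finally show ?thesis .
qed

section \<open>Euclidean norm and unitary matrices\<close>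

definition vnorm :: "complex vec \<Rightarrow> real" where
  "vnorm x = L2_set (\<lambda>i. cmod (x $ i)) {..<dim_vec x}"

lemma vnorm_nonneg [simp]: "0 \<le> vnorm x"
  by (simp add: vnorm_def)

lemma cscalar_prod_self: "x \<bullet>c x = complex_of_real ((vnorm x)\<^sup>2)"
  by (simp add: cscalar_prod_sum vnorm_def L2_set_def sum_nonneg complex_norm_square del: of_real_power)

lemma cscalar_prod_le_vnorm:
  assumes "dim_vec x = dim_vec y"
  shows "cmod (x \<bullet>c y) \<le> vnorm x * vnorm y"
proof -
  have "cmod (x \<bullet>c y) \<le> (\<Sum>i<dim_vec y. \<bar>cmod (x $ i)\<bar> * \<bar>cmod (y $ i)\<bar>)"
    unfolding cscalar_prod_sum by (intro order.trans[OF norm_sum] sum_mono) (simp add: norm_mult)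
  also have "\<dots> \<le> vnorm x * vnorm y"
    unfolding vnorm_def assms by (rule L2_set_mult_ineq)
  finally show ?thesis .
qed

definition unitary :: "nat \<Rightarrow> complex mat \<Rightarrow> bool" where
  "unitary n U \<longleftrightarrow> U \<in> square_mats n \<and> mat_adjoint U * U = 1\<^sub>m n"

lemma unitary_carrier: "unitary n U \<Longrightarrow> U \<in> square_mats n"
  by (simp add: unitary_def)

lemma unitary_dim: "unitary n U \<Longrightarrow> dim_row U = n \<and> dim_col U = n"
  by (auto simp: unitary_def)

lemma unitary_left: "unitary n U \<Longrightarrow> mat_adjoint U * U = 1\<^sub>m n"
  by (simp add: unitary_def)

lemma unitary_right: "unitary n U \<Longrightarrow> U * mat_adjoint U = 1\<^sub>m n"
  using mat_mult_left_right_inverse[of "mat_adjoint U" n U] by (simp add: unitary_def)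

text \<open>Right-nested, because this is the shape that products have after rewriting with
  \<open>mult_assoc_dim\<close>.\<close>

lemma unitary_cancel:
  assumes "unitary n U" "dim_row Z = n"
  shows "mat_adjoint U * (U * Z) = Z" "U * (mat_adjoint U * Z) = Z"
  using assms unitary_dim[OF assms(1)]
  by (simp_all flip: mult_assoc_dim add: unitary_left unitary_right one_mult_dim)

lemma unitary_one: "unitary n (1\<^sub>m n)"
  by (auto simp: unitary_def)

lemma unitary_adjoint: "unitary n U \<Longrightarrow> unitary n (mat_adjoint U)"
  using unitary_right[of n U] by (auto simp: unitary_def)

lemma unitary_mult: "unitary n U \<Longrightarrow> unitary n W \<Longrightarrow> unitary n (U * W)"
  using unitary_cancel(1)[of n U W]
  by (auto simp: unitary_def mat_adjoint_mult mult_assoc_dim)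

text \<open>Complete \<open>v\<close> to a basis, orthogonalise and normalise the columns.
  Gram-Schmidt leaves the first vector unchanged, so the first column is \<open>v\<close> divided by
  its norm.\<close>

lemma unitary_with_first_col:
  fixes v :: "complex vec"
  assumes v: "v \<in> carrier_vec n" "v \<noteq> 0\<^sub>v n"
  shows "\<exists>W c. unitary n W \<and> col W 0 = c \<cdot>\<^sub>v v"
proof -
  interpret cof_vec_space n "TYPE(complex)" .
  define b where "b = basis_completion v"
  note b = basis_completion[OF v, folded b_def]
  have n: "n > 0" using v by (intro gr0I) auto
  with b obtain vs where bv: "b = v # vs" by (cases b) auto
  define ws where "ws = gram_schmidt n b"
  have ws: "set ws \<subseteq> carrier_vec n" "corthogonal ws" "length ws = n"
    using gram_schmidt_result[of b ws] b by (auto simp: ws_def)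
  have hd: "ws ! 0 = v"
  proof -
    have "ws \<noteq> []" using ws n by auto
    thus ?thesis using gram_schmidt_hd[OF v(1), of vs] by (simp add: ws_def bv hd_conv_nth)
  qed
  have dim: "dim_vec (ws ! i) = n" if "i < n" for i
    using ws(1,3) that nth_mem[of i ws] by (metis carrier_vecD subsetD)
  define W where "W = mat n n (\<lambda>(i, j). (ws ! j) $ i / complex_of_real (vnorm (ws ! j)))"
  have orth: "(ws ! j) \<bullet>c (ws ! i) = (if i = j then complex_of_real ((vnorm (ws ! i))\<^sup>2) else 0)"
    and nz: "vnorm (ws ! i) \<noteq> 0" if "i < n" "j < n" for i j
    using corthogonalD[OF ws(2), of j i] corthogonalD[OF ws(2), of i i] that ws(3)
    by (auto simp: cscalar_prod_self)
  have "mat_adjoint W * W = 1\<^sub>m n"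
  proof (rule eq_matI)
    fix i j assume "i < dim_row (1\<^sub>m n :: complex mat)" "j < dim_col (1\<^sub>m n :: complex mat)"
    hence ij: "i < n" "j < n" by auto
    have "(mat_adjoint W * W) $$ (i, j)
        = (\<Sum>k<n. (ws ! j) $ k * cnj ((ws ! i) $ k)) / (complex_of_real (vnorm (ws ! i)) * complex_of_real (vnorm (ws ! j)))"
      using ij by (simp add: index_mult_mat_sum W_def sum_divide_distrib mult.commute del: index_mult_mat(1))
    also have "(\<Sum>k<n. (ws ! j) $ k * cnj ((ws ! i) $ k)) = (ws ! j) \<bullet>c (ws ! i)"
      using ij by (simp add: cscalar_prod_sum dim)
    finally show "(mat_adjoint W * W) $$ (i, j) = 1\<^sub>m n $$ (i, j)"
      using orth[OF ij] nz[OF ij] ij by (auto simp: power2_eq_square)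
  qed (auto simp: W_def)
  moreover have "col W 0 = (1 / complex_of_real (vnorm v)) \<cdot>\<^sub>v v"
    using n v by (intro eq_vecI) (auto simp: W_def hd)
  moreover have "W \<in> square_mats n" by (simp add: W_def)
  ultimately show ?thesis by (auto simp: unitary_def)
qed

section \<open>Diagonalisation of Hermitian matrices\<close>

lemma mult_diagonal_blocks:
  fixes A B C D :: "complex mat"
  assumes "A \<in> carrier_mat m m" "B \<in> carrier_mat m m" "C \<in> carrier_mat n n" "D \<in> carrier_mat n n"
  shows "four_block_mat A (0\<^sub>m m n) (0\<^sub>m n m) C * four_block_mat B (0\<^sub>m m n) (0\<^sub>m n m) D
    = four_block_mat (A * B) (0\<^sub>m m n) (0\<^sub>m n m) (C * D)"
  using assms
  by (subst mult_four_block_mat[OF assms(1) zero_carrier_mat zero_carrier_mat assms(3)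
        assms(2) zero_carrier_mat zero_carrier_mat assms(4)]) auto

lemma unitary_four_block:
  assumes U: "unitary n U"
  shows "unitary (Suc n) (four_block_mat (1\<^sub>m 1) (0\<^sub>m 1 n) (0\<^sub>m n 1) U)" (is "unitary _ ?M")
    and "mat_adjoint (four_block_mat (1\<^sub>m 1) (0\<^sub>m 1 n) (0\<^sub>m n 1) U)
      = four_block_mat (1\<^sub>m 1) (0\<^sub>m 1 n) (0\<^sub>m n 1) (mat_adjoint U)"
proof -
  have c: "U \<in> carrier_mat n n" using U by (simp add: unitary_def)
  show adj: "mat_adjoint ?M = four_block_mat (1\<^sub>m 1) (0\<^sub>m 1 n) (0\<^sub>m n 1) (mat_adjoint U)"
    using c by (intro eq_matI) (auto simp: four_block_mat_def Let_def)
  have "mat_adjoint ?M * ?M = four_block_mat (1\<^sub>m 1) (0\<^sub>m 1 n) (0\<^sub>m n 1) (1\<^sub>m n)"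
    unfolding adj using c by (subst mult_four_block_mat[of _ 1 1 _ n _ n]) (auto simp: unitary_left[OF U])
  thus "unitary (Suc n) ?M" using c by (auto simp: unitary_def)
qed

text \<open>Induction by deflation. In a basis that begins with an eigenvector the first column
  vanishes below the corner; Hermiticity makes the first row vanish as well, and the remaining block
  is Hermitian of size \<open>n\<close>.\<close>

theorem hermitian_spectral:
  assumes "A \<in> square_mats n" "mat_adjoint A = A"
  shows "\<exists>U s. unitary n U \<and> A = U * mat_diag n s * mat_adjoint U"
  using assms
proof (induction n arbitrary: A)
  case 0
  have "A = 1\<^sub>m 0 * mat_diag 0 (\<lambda>_. 0) * mat_adjoint (1\<^sub>m 0)"
    using 0 by (intro eq_matI) auto
  with unitary_one show ?case by blast
next
  case (Suc n)
  let ?N = "Suc n"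
  have dA [simp]: "dim_row A = ?N" "dim_col A = ?N" using Suc.prems by auto
  obtain e v where ev: "v \<in> carrier_vec ?N" "v \<noteq> 0\<^sub>v ?N" "A *\<^sub>v v = e \<cdot>\<^sub>v v"
    using spectrum_non_empty[OF Suc.prems(1)]
    by (auto simp: spectrum_def eigenvalue_def eigenvector_def)
  obtain W c where W: "unitary ?N W" and col: "col W 0 = c \<cdot>\<^sub>v v"
    using unitary_with_first_col[OF ev(1,2)] by blast
  note dW [simp] = unitary_dim[OF W, THEN conjunct1] unitary_dim[OF W, THEN conjunct2]
  define A' where "A' = mat_adjoint W * (A * W)"
  have dA' [simp]: "dim_row A' = ?N" "dim_col A' = ?N" by (auto simp: A'_def)
  have herm: "mat_adjoint A' = A'"
    by (simp add: A'_def mat_adjoint_mult mult_assoc_dim Suc.prems(2))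
  have Wc: "W \<in> carrier_mat ?N ?N" using W by (simp add: unitary_def)
  have "col A' 0 = mat_adjoint W *\<^sub>v (A *\<^sub>v col W 0)"
    unfolding A'_def using Wc Suc.prems(1)
    by (subst col_mult2[of _ ?N ?N _ ?N]; (subst col_mult2[of _ ?N ?N _ ?N])?) auto
  also have "A *\<^sub>v col W 0 = e \<cdot>\<^sub>v col W 0"
    using ev Suc.prems(1) by (simp add: col mult_mat_vec[of _ ?N ?N] smult_smult_assoc mult.commute)
  also have "mat_adjoint W *\<^sub>v (e \<cdot>\<^sub>v col W 0) = e \<cdot>\<^sub>v (mat_adjoint W *\<^sub>v col W 0)"
    using Wc by (intro mult_mat_vec[of _ ?N ?N]) (auto intro: carrier_vecI)
  also have "mat_adjoint W *\<^sub>v col W 0 = col (mat_adjoint W * W) 0"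
    using Wc by (subst col_mult2[of _ ?N ?N _ ?N]) auto
  also have "\<dots> = unit_vec ?N 0"
    by (simp add: unitary_left[OF W])
  finally have col0: "col A' 0 = e \<cdot>\<^sub>v unit_vec ?N 0" .
  have c0: "A' $$ (i, 0) = (if i = 0 then e else 0)" if "i < ?N" for i
    using arg_cong[OF col0, of "\<lambda>v. v $ i"] that by auto
  have r0: "A' $$ (0, i) = (if i = 0 then e else 0)" if "i < ?N" for i
    using arg_cong[OF herm, of "\<lambda>M. M $$ (0, i)"] c0[OF that] c0[of 0] that by (auto split: if_splits)
  define A3 where "A3 = mat n n (\<lambda>(i, j). A' $$ (Suc i, Suc j))"
  have A3c: "A3 \<in> square_mats n" by (simp add: A3_def)
  have "mat_adjoint A3 = A3"
  proof (rule eq_matI)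
    fix i j assume "i < dim_row A3" "j < dim_col A3"
    thus "mat_adjoint A3 $$ (i, j) = A3 $$ (i, j)"
      using arg_cong[OF herm, of "\<lambda>M. M $$ (Suc i, Suc j)"] by (auto simp: A3_def)
  qed (auto simp: A3_def)
  from Suc.IH[OF A3c this] obtain U s where U: "unitary n U" and A3: "A3 = U * mat_diag n s * mat_adjoint U"
    by blast
  have Uc: "U \<in> carrier_mat n n" using U by (simp add: unitary_def)
  let ?M = "four_block_mat (1\<^sub>m 1) (0\<^sub>m 1 n) (0\<^sub>m n 1) U"
  \<comment> \<open>\<open>case_nat e s\<close> prepends the eigenvalue \<open>e\<close> just found
    to those of the smaller block.\<close>
  let ?D = "mat_diag ?N (case_nat e s)"
  have A'4: "A' = four_block_mat (mat_diag 1 (\<lambda>_. e)) (0\<^sub>m 1 n) (0\<^sub>m n 1) A3"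
    using c0 r0 by (intro eq_matI) (auto simp: four_block_mat_def Let_def A3_def)
  have D: "?D = four_block_mat (mat_diag 1 (\<lambda>_. e)) (0\<^sub>m 1 n) (0\<^sub>m n 1) (mat_diag n s)"
    by (intro eq_matI) (auto simp: four_block_mat_def Let_def split: nat.split)
  have A'M: "A' = ?M * ?D * mat_adjoint ?M"
    unfolding unitary_four_block(2)[OF U] D A'4 A3 using Uc
    by (simp add: mult_diagonal_blocks)
  have "A = W * (A' * mat_adjoint W)"
    using W by (simp add: A'_def mult_assoc_dim unitary_cancel unitary_right mult_one_dim)
  also have "\<dots> = (W * ?M) * ?D * mat_adjoint (W * ?M)"
    using Uc by (simp add: A'M mult_assoc_dim mat_adjoint_mult)
  finally show ?case using unitary_mult[OF W unitary_four_block(1)[OF U]] by blast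
qed

subsection \<open>Positive semidefinite matrices and their square roots\<close>

lemma cscalar_prod_unit_vec:
  fixes A :: "complex mat"
  assumes "A \<in> square_mats n" "i < n" "j < n"
  shows "(A *\<^sub>v unit_vec n j) \<bullet>c unit_vec n i = A $$ (i, j)"
  using assms
  by (simp add: cscalar_prod_sum index_mult_mat_vec_sum if_distrib cong: if_cong del: index_mult_mat_vec)

lemma psd_diag_entry: "psd n A \<Longrightarrow> i < n \<Longrightarrow> 0 \<le> A $$ (i, i)"
  by (metis cscalar_prod_unit_vec psd_def unit_vec_carrier)

text \<open>Polarisation: a quadratic form with real values determines the off-diagonal entries up
  to conjugation.\<close>

lemma psd_hermitian:
  assumes A: "psd n A"
  shows "mat_adjoint A = A"
proof (rule eq_matI)
  have Ac: "A \<in> square_mats n" using A by (simp add: psd_def)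
  fix i j assume "i < dim_row A" "j < dim_col A"
  hence ij: "i < n" "j < n" using Ac by auto
  have q: "(A *\<^sub>v (unit_vec n i + a \<cdot>\<^sub>v unit_vec n j)) \<bullet>c (unit_vec n i + a \<cdot>\<^sub>v unit_vec n j)
     = A $$ (i, i) + cnj a * A $$ (j, i) + a * A $$ (i, j) + a * cnj a * A $$ (j, j)" for a
  proof -
    let ?x = "unit_vec n i" and ?y = "unit_vec n j :: complex vec"
    have "A *\<^sub>v (?x + a \<cdot>\<^sub>v ?y) = A *\<^sub>v ?x + a \<cdot>\<^sub>v (A *\<^sub>v ?y)"
      using Ac by (subst mult_add_distrib_mat_vec[of _ n n]) (auto simp: mult_mat_vec[of _ n n])
    moreover have "conjugate (?x + a \<cdot>\<^sub>v ?y) = conjugate ?x + cnj a \<cdot>\<^sub>v conjugate ?y"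
      by (subst conjugate_add_vec[of _ n]) (auto simp: conjugate_smult_vec)
    moreover have "A *\<^sub>v unit_vec n k \<in> carrier_vec n" for k
      using Ac by (intro mult_mat_vec_carrier[of _ n n]) auto
    ultimately show ?thesis
      using ij Ac
      by (simp add: add_scalar_prod_distrib[of _ n] scalar_prod_add_distrib[of _ n]
          cscalar_prod_unit_vec algebra_simps)
  qed
  have "0 \<le> A $$ (i, i) + cnj a * A $$ (j, i) + a * A $$ (i, j) + a * cnj a * A $$ (j, j)" for a
    using A unfolding q[symmetric] psd_def by auto
  \<comment> \<open>Since the diagonal entries are real, \<open>a = 1\<close> makes the imaginary
    parts of the two entries opposite and \<open>a = \<i>\<close> makes their real parts
    equal.\<close>
  from this[of 1] this[of \<i>] psd_diag_entry[OF A ij(1)] psd_diag_entry[OF A ij(2)]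
  have "cnj (A $$ (j, i)) = A $$ (i, j)"
    by (auto simp: complex_eq_iff less_eq_complex_def)
  thus "mat_adjoint A $$ (i, j) = A $$ (i, j)" using ij Ac by simp
qed (use A in \<open>auto simp: psd_def\<close>)

text \<open>The form of the new matrix at \<open>v\<close> is the form of \<open>A\<close> at the
  image of \<open>v\<close> under the adjoint of \<open>X\<close>.\<close>

lemma psd_congruence:
  assumes A: "psd m A" and X: "X \<in> carrier_mat n m"
  shows "psd n (X * A * mat_adjoint X)"
  unfolding psd_def
proof (intro conjI ballI)
  have Ac: "A \<in> carrier_mat m m" using A by (simp add: psd_def)
  show "X * A * mat_adjoint X \<in> square_mats n" using X Ac by auto
  fix v :: "complex vec" assume v: "v \<in> carrier_vec n"
  let ?w = "mat_adjoint X *\<^sub>v v"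
  have w: "?w \<in> carrier_vec m" using X by (auto intro!: carrier_vecI)
  have "(X * A * mat_adjoint X *\<^sub>v v) = X *\<^sub>v (A *\<^sub>v ?w)"
    using X Ac v w by (simp add: assoc_mult_mat_vec[of _ n m _ n] assoc_mult_mat_vec[of _ n m _ m])
  also have "(X *\<^sub>v (A *\<^sub>v ?w)) \<bullet>c v = (A *\<^sub>v ?w) \<bullet>c ?w"
    using X Ac v w by (intro cscalar_prod_adjoint) (auto intro!: carrier_vecI)
  also have "\<dots> \<ge> 0" using A w by (simp add: psd_def)
  finally show "0 \<le> (X * A * mat_adjoint X *\<^sub>v v) \<bullet>c v" .
qed

lemma diag_mult_vec:
  "v \<in> carrier_vec n \<Longrightarrow> mat_diag n s *\<^sub>v v = vec n (\<lambda>i. s i * (v $ i :: complex))"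
  by (intro eq_vecI)
    (auto simp: index_mult_mat_vec_sum if_distrib[of "\<lambda>x. x * _"] cong: if_cong simp del: index_mult_mat_vec)

lemma psd_diag:
  assumes "\<And>i. i < n \<Longrightarrow> 0 \<le> s i"
  shows "psd n (mat_diag n (\<lambda>i. complex_of_real (s i)))"
  using assms
  by (auto simp: psd_def diag_mult_vec cscalar_prod_sum complex_norm_square[symmetric] mult.assoc
      simp flip: of_real_power of_real_mult intro!: sum_nonneg) (auto simp: less_eq_complex_def)

lemma psd_gram:
  assumes "X \<in> carrier_mat n m"
  shows "psd m (mat_adjoint X * X)"
  using psd_congruence[of n "1\<^sub>m n" "mat_adjoint X" m] psd_diag[of n "\<lambda>_. 1"] assms by simp

theorem psd_spectral:
  assumes "psd n A"
  shows "\<exists>U s. unitary n U \<and> (\<forall>i. 0 \<le> s i) \<and>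
    A = U * mat_diag n (\<lambda>i. complex_of_real (s i)) * mat_adjoint U"
proof -
  have Ac: "A \<in> square_mats n" using assms by (simp add: psd_def)
  obtain U r where U: "unitary n U" and A: "A = U * mat_diag n r * mat_adjoint U"
    using hermitian_spectral[OF Ac psd_hermitian[OF assms]] by blast
  note dU [simp] = unitary_dim[OF U, THEN conjunct1] unitary_dim[OF U, THEN conjunct2]
  have "mat_adjoint U * A * mat_adjoint (mat_adjoint U) = mat_diag n r"
    using U by (simp add: A mult_assoc_dim unitary_cancel unitary_left mult_one_dim)
  hence "psd n (mat_diag n r)"
    using psd_congruence[OF assms, of "mat_adjoint U" n] unitary_carrier[OF U] by simp
  hence pos: "0 \<le> r i" if "i < n" for i
    using psd_diag_entry[of n _ i] that by fastforce
  \<comment> \<open>The diagonal values have a sign only below \<open>n\<close>; the absolute value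
    extends it to every index, so that later uses carry no range condition.\<close>
  have "mat_diag n r = mat_diag n (\<lambda>i. complex_of_real \<bar>Re (r i)\<bar>)"
    using pos by (intro eq_matI) (auto simp: complex_eq_iff less_eq_complex_def)
  thus ?thesis
    using U A by (intro exI[of _ U] exI[of _ "\<lambda>i. \<bar>Re (r i)\<bar>"]) auto
qed

lemma unitary_diag_square:
  assumes "unitary n U"
  shows "(U * mat_diag n s * mat_adjoint U) * (U * mat_diag n r * mat_adjoint U)
    = U * mat_diag n (\<lambda>i. s i * r i) * mat_adjoint U"
  using assms unitary_dim[OF assms]
  by (simp add: mult_assoc_dim unitary_cancel flip: mat_diag_diag)

text \<open>In eigenbases of \<open>B\<close> and \<open>S\<close> the hypothesis says that the
  transition matrix \<open>M\<close> intertwines the squared eigenvalues. So wherever an entry of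
  \<open>M\<close> is nonzero the two squares agree, hence so do the nonnegative eigenvalues
  themselves, and \<open>M\<close> intertwines these too.\<close>

lemma psd_sqrt_unique:
  assumes B: "psd n B" and S: "psd n S" and eq: "B * B = S * S"
  shows "B = S"
proof -
  obtain U b where U: "unitary n U" and b: "\<And>i. (0::real) \<le> b i"
    and Bd: "B = U * mat_diag n (\<lambda>i. complex_of_real (b i)) * mat_adjoint U"
    using psd_spectral[OF B] by blast
  obtain V s where V: "unitary n V" and s: "\<And>i. (0::real) \<le> s i"
    and Sd: "S = V * mat_diag n (\<lambda>i. complex_of_real (s i)) * mat_adjoint V"
    using psd_spectral[OF S] by blast
  note d [simp] = unitary_dim[OF U, THEN conjunct1] unitary_dim[OF U, THEN conjunct2]
    unitary_dim[OF V, THEN conjunct1] unitary_dim[OF V, THEN conjunct2]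
  define M where "M = mat_adjoint V * U"
  have M: "M \<in> carrier_mat n n" by (auto simp: M_def)
  let ?b2 = "mat_diag n (\<lambda>i. complex_of_real (b i) * complex_of_real (b i))"
  let ?s2 = "mat_diag n (\<lambda>i. complex_of_real (s i) * complex_of_real (s i))"
  have "mat_adjoint V * (U * ?b2 * mat_adjoint U) * U = mat_adjoint V * (V * ?s2 * mat_adjoint V) * U"
    using eq by (simp add: Bd Sd unitary_diag_square U V)
  hence M2: "M * ?b2 = ?s2 * M"
    using U V by (simp add: M_def mult_assoc_dim unitary_cancel unitary_left mult_one_dim)
  have "M * mat_diag n (\<lambda>i. complex_of_real (b i)) = mat_diag n (\<lambda>i. complex_of_real (s i)) * M"
  proof (rule eq_matI)
    fix i j assume "i < dim_row (mat_diag n (\<lambda>i. complex_of_real (s i)) * M)"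
      "j < dim_col (mat_diag n (\<lambda>i. complex_of_real (s i)) * M)"
    hence ij: "i < n" "j < n" using M by auto
    have "M $$ (i, j) * complex_of_real (b j * b j) = complex_of_real (s i * s i) * M $$ (i, j)"
      using arg_cong[OF M2, of "\<lambda>M. M $$ (i, j)"] M ij
      by (simp add: mat_diag_mult_left[OF M] mat_diag_mult_right[OF M])
    hence "M $$ (i, j) = 0 \<or> b j * b j = s i * s i"
      by (metis mult.commute mult_cancel_left of_real_eq_iff)
    hence "M $$ (i, j) = 0 \<or> b j = s i"
      using b[of j] s[of i] by (metis abs_of_nonneg real_sqrt_mult_self real_sqrt_mult)
    thus "(M * mat_diag n (\<lambda>i. complex_of_real (b i))) $$ (i, j)
        = (mat_diag n (\<lambda>i. complex_of_real (s i)) * M) $$ (i, j)"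
      using ij by (auto simp: mat_diag_mult_left[OF M] mat_diag_mult_right[OF M])
  qed (use M in auto)
  hence "V * (M * mat_diag n (\<lambda>i. complex_of_real (b i))) * mat_adjoint U
       = V * (mat_diag n (\<lambda>i. complex_of_real (s i)) * M) * mat_adjoint U" by simp
  thus ?thesis
    using U V by (simp add: M_def Bd Sd mult_assoc_dim unitary_cancel unitary_right mult_one_dim)
qed

lemma psd_sqrt_eqI:
  assumes "psd n B" "B * B = A"
  shows "psd_sqrt A = B"
proof -
  have "dim_row A = n" using assms by (auto simp: psd_def)
  thus ?thesis unfolding psd_sqrt_def
    using assms psd_sqrt_unique by (intro the_equality) auto
qed

subsection \<open>The trace norm\<close>

lemma mat_trace_mult_commute:
  assumes "A \<in> carrier_mat n m" "B \<in> carrier_mat m n"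
  shows "mat_trace (A * B) = mat_trace (B * A)"
proof -
  have "mat_trace (A * B) = (\<Sum>i<n. \<Sum>k<m. A $$ (i, k) * B $$ (k, i))"
    using assms by (simp add: mat_trace_def index_mult_mat_sum del: index_mult_mat(1))
  also have "\<dots> = (\<Sum>k<m. \<Sum>i<n. A $$ (i, k) * B $$ (k, i))"
    by (rule sum.swap)
  also have "\<dots> = mat_trace (B * A)"
    using assms by (simp add: mat_trace_def index_mult_mat_sum mult.commute del: index_mult_mat(1))
  finally show ?thesis .
qed

lemma mat_trace_unitary:
  assumes "unitary n U" "A \<in> square_mats n"
  shows "mat_trace (mat_adjoint U * A * U) = mat_trace A"
    and "mat_trace (U * A * mat_adjoint U) = mat_trace A"
proof -
  note dU = unitary_dim[OF assms(1)] unitary_carrier[OF assms(1)]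
  show "mat_trace (U * A * mat_adjoint U) = mat_trace A"
    using assms dU
    by (subst mat_trace_mult_commute[of _ n n]) (auto simp flip: mult_assoc_dim simp: unitary_left one_mult_dim)
  show "mat_trace (mat_adjoint U * A * U) = mat_trace A"
    using assms dU
    by (subst mat_trace_mult_commute[of _ n n]) (auto simp flip: mult_assoc_dim simp: unitary_right one_mult_dim)
qed

lemma mat_trace_add:
  "A \<in> square_mats n \<Longrightarrow> B \<in> square_mats n \<Longrightarrow> mat_trace (A + B) = mat_trace A + mat_trace B"
  by (simp add: mat_trace_def sum.distrib)

lemma mat_trace_smult: "A \<in> square_mats n \<Longrightarrow> mat_trace (a \<cdot>\<^sub>m A) = a * mat_trace A"
  by (simp add: mat_trace_def sum_distrib_left)

lemma mat_trace_diag: "mat_trace (mat_diag n s) = (\<Sum>i<n. s i)"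
  by (simp add: mat_trace_def)

lemma trace_norm_psd: "psd n A \<Longrightarrow> trace_norm A = Re (mat_trace A)"
  using psd_hermitian[of n A] psd_sqrt_eqI[of n A] by (simp add: trace_norm_def)

text \<open>The \<open>s i\<close> are the singular values of \<open>X\<close> and the columns of
  \<open>V\<close> its right singular vectors. Left singular vectors are avoided, as they are not
  determined on the kernel.\<close>

lemma trace_norm_singular_values:
  assumes X: "X \<in> square_mats n"
  obtains V s where "unitary n V" "\<And>i. 0 \<le> s i"
    "mat_adjoint V * (mat_adjoint X * X) * V = mat_diag n (\<lambda>i. complex_of_real ((s i)\<^sup>2))"
    "trace_norm X = (\<Sum>i<n. s i)"
proof -
  obtain V r where V: "unitary n V" and r: "\<And>i. (0::real) \<le> r i"
    and d: "mat_adjoint X * X = V * mat_diag n (\<lambda>i. complex_of_real (r i)) * mat_adjoint V"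
    using psd_spectral[OF psd_gram[OF X]] by blast
  note dV [simp] = unitary_dim[OF V, THEN conjunct1] unitary_dim[OF V, THEN conjunct2]
  let ?D = "mat_diag n (\<lambda>i. complex_of_real (sqrt (r i)))"
  have "psd_sqrt (mat_adjoint X * X) = V * ?D * mat_adjoint V"
  proof (rule psd_sqrt_eqI)
    show "psd n (V * ?D * mat_adjoint V)"
      using r by (intro psd_congruence[of n] psd_diag unitary_carrier[OF V]) auto
    show "(V * ?D * mat_adjoint V) * (V * ?D * mat_adjoint V) = mat_adjoint X * X"
      unfolding unitary_diag_square[OF V] d using r by (simp flip: of_real_mult)
  qed
  hence tn: "trace_norm X = (\<Sum>i<n. sqrt (r i))"
    using V by (simp add: trace_norm_def mat_trace_unitary mat_trace_diag)
  moreover have "mat_adjoint V * (mat_adjoint X * X) * V = mat_diag n (\<lambda>i. complex_of_real (r i))"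
    using V unfolding d by (simp add: mult_assoc_dim unitary_cancel unitary_left mult_one_dim)
  ultimately show ?thesis
    using V r by (intro that[of V "\<lambda>i. sqrt (r i)"]) (simp_all add: real_sqrt_pow2)
qed

text \<open>The unit ball of the operator norm, which is dual to the trace norm under the pairing
  \<open>mat_trace (C * X)\<close>.\<close>

definition contraction :: "nat \<Rightarrow> complex mat \<Rightarrow> bool" where
  "contraction n C \<longleftrightarrow> C \<in> square_mats n \<and> (\<forall>w\<in>carrier_vec n. vnorm (C *\<^sub>v w) \<le> vnorm w)"

lemma vnorm_mult_vec:
  assumes "A \<in> carrier_mat m n" "x \<in> carrier_vec n"
  shows "complex_of_real ((vnorm (A *\<^sub>v x))\<^sup>2) = (mat_adjoint A * A *\<^sub>v x) \<bullet>c x"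
proof -
  have "(mat_adjoint A * A *\<^sub>v x) \<bullet>c x = (mat_adjoint A *\<^sub>v (A *\<^sub>v x)) \<bullet>c x"
    using assms by (subst assoc_mult_mat_vec[of _ n m _ n]) auto
  also have "\<dots> = (A *\<^sub>v x) \<bullet>c (A *\<^sub>v x)"
    using assms by (subst cscalar_prod_adjoint[of _ n m]) (auto intro!: carrier_vecI)
  finally show ?thesis by (simp only: cscalar_prod_self)
qed

lemma contraction_carrier: "contraction n C \<Longrightarrow> C \<in> square_mats n"
  by (simp add: contraction_def)

lemma contraction_mult: "contraction n C \<Longrightarrow> contraction n D \<Longrightarrow> contraction n (C * D)"
  unfolding contraction_def
  by (auto simp: assoc_mult_mat_vec[of _ n n _ n] intro: order.trans intro!: mult_mat_vec_carrier)

text \<open>For \<open>z\<close> the image of \<open>w\<close> under the adjoint, the square of its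
  norm is the inner product of \<open>C *\<^sub>v z\<close> with \<open>w\<close>. Cauchy-Schwarz
  bounds this by \<open>vnorm z * vnorm w\<close>, and one factor cancels unless it is zero.\<close>

lemma contraction_adjoint:
  assumes "contraction n C"
  shows "contraction n (mat_adjoint C)"
  unfolding contraction_def
proof (intro conjI ballI)
  have C: "C \<in> square_mats n" using assms by (simp add: contraction_def)
  thus "mat_adjoint C \<in> square_mats n" by simp
  fix w :: "complex vec" assume w: "w \<in> carrier_vec n"
  let ?z = "mat_adjoint C *\<^sub>v w"
  have z: "?z \<in> carrier_vec n" using C w by (auto intro!: carrier_vecI)
  have "complex_of_real ((vnorm ?z)\<^sup>2) = (C *\<^sub>v ?z) \<bullet>c w"
    using C w z by (subst cscalar_prod_adjoint[of _ n n]) (auto simp: cscalar_prod_self)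
  hence "(vnorm ?z)\<^sup>2 = cmod ((C *\<^sub>v ?z) \<bullet>c w)"
    by (metis abs_power2 norm_of_real)
  also have "\<dots> \<le> vnorm (C *\<^sub>v ?z) * vnorm w"
    using C w by (intro cscalar_prod_le_vnorm) auto
  also have "\<dots> \<le> vnorm ?z * vnorm w"
    using assms z by (intro mult_right_mono) (auto simp: contraction_def)
  finally show "vnorm ?z \<le> vnorm w"
    by (cases "vnorm ?z = 0") (auto simp: power2_eq_square mult_le_cancel_left order.not_eq_order_implies_strict)
qed

lemma contraction_unitary:
  assumes U: "unitary n U"
  shows "contraction n U"
  unfolding contraction_def
proof (intro conjI ballI)
  fix w :: "complex vec" assume w: "w \<in> carrier_vec n"
  have "complex_of_real ((vnorm (U *\<^sub>v w))\<^sup>2) = complex_of_real ((vnorm w)\<^sup>2)"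
    using vnorm_mult_vec[OF unitary_carrier[OF U] w] w by (simp only: unitary_left[OF U] one_mult_mat_vec cscalar_prod_self)
  hence "(vnorm (U *\<^sub>v w))\<^sup>2 = (vnorm w)\<^sup>2" by (simp only: of_real_eq_iff)
  thus "vnorm (U *\<^sub>v w) \<le> vnorm w" by simp
qed (rule unitary_carrier[OF U])

lemma contraction_diag:
  assumes "\<And>i. i < n \<Longrightarrow> cmod (s i) \<le> 1"
  shows "contraction n (mat_diag n s)"
  using assms unfolding contraction_def
  by (auto simp: diag_mult_vec vnorm_def norm_mult intro!: L2_set_mono mult_left_le_one_le)

lemma contraction_mat_unit:
  assumes "i < n" "j < n"
  shows "contraction n (mat_unit n i j)"
  unfolding contraction_def
proof (intro conjI ballI)
  fix w :: "complex vec" assume w: "w \<in> carrier_vec n"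
  have "mat_unit n i j *\<^sub>v w = vec n (\<lambda>k. if k = i then w $ j else 0)"
    using w assms
    by (intro eq_vecI)
      (auto simp: mat_unit_def index_mult_mat_vec_sum if_distrib[of "\<lambda>x. x * _"] cong: if_cong
        simp del: index_mult_mat_vec)
  hence "vnorm (mat_unit n i j *\<^sub>v w) = L2_set (\<lambda>k. cmod (if k = i then w $ j else 0)) {..<n}"
    by (simp add: vnorm_def cong: L2_set_cong_simp)
  also have "\<dots> \<le> (\<Sum>k<n. cmod (if k = i then w $ j else 0))"
    by (intro L2_set_le_sum) auto
  also have "\<dots> = cmod (w $ j)" using assms by (simp add: if_distrib cong: if_cong)
  also have "\<dots> \<le> vnorm w"
    unfolding vnorm_def using assms w by (intro member_le_L2_set) auto
  finally show "vnorm (mat_unit n i j *\<^sub>v w) \<le> vnorm w" .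
qed (simp add: mat_unit_def)

lemma sandwich_entry:
  assumes "A \<in> square_mats n" "V \<in> square_mats n" "i < n" "j < n"
  shows "(mat_adjoint V * A * V) $$ (i, j) = (A *\<^sub>v col V j) \<bullet>c col V i"
proof -
  have c: "col V k \<in> carrier_vec n" for k using assms by (auto intro!: carrier_vecI)
  have "(mat_adjoint V * A * V) $$ (i, j) = (mat_adjoint V * A * V *\<^sub>v unit_vec n j) \<bullet>c unit_vec n i"
    using assms by (subst cscalar_prod_unit_vec) auto
  also have "mat_adjoint V * A * V *\<^sub>v unit_vec n j = mat_adjoint V *\<^sub>v (A *\<^sub>v col V j)"
    using assms c
    by (subst assoc_mult_mat_vec[of _ n n _ n], (auto)[3], subst assoc_mult_mat_vec[of _ n n _ n])
      (auto simp: mult_unit_vec[of _ n n])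
  also have "\<dots> \<bullet>c unit_vec n i = (A *\<^sub>v col V j) \<bullet>c (V *\<^sub>v unit_vec n i)"
    using assms c by (subst cscalar_prod_adjoint[of _ n n]) (auto intro!: carrier_vecI)
  also have "V *\<^sub>v unit_vec n i = col V i"
    using assms by (simp add: mult_unit_vec[of _ n n])
  finally show ?thesis .
qed

text \<open>Take the trace in the basis of right singular vectors. Each term is at most the norm of
  the image of such a vector under \<open>C * X\<close>, and \<open>X\<close> stretches the
  \<open>k\<close>-th of them by exactly \<open>s k\<close>.\<close>

theorem trace_norm_ge:
  assumes C: "contraction n C" and X: "X \<in> square_mats n"
  shows "cmod (mat_trace (C * X)) \<le> trace_norm X"
proof -
  obtain V s where V: "unitary n V" and s: "\<And>i. (0::real) \<le> s i"
    and d: "mat_adjoint V * (mat_adjoint X * X) * V = mat_diag n (\<lambda>i. complex_of_real ((s i)\<^sup>2))"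
    and tn: "trace_norm X = (\<Sum>i<n. s i)"
    using trace_norm_singular_values[OF X] by blast
  have Cc: "C \<in> square_mats n" and Vc: "V \<in> square_mats n"
    using C V by (auto simp: contraction_def unitary_def)
  have c: "col V k \<in> carrier_vec n" for k using Vc by (auto intro!: carrier_vecI)
  have XVk: "X *\<^sub>v col V k \<in> carrier_vec n" for k using X by (auto intro!: carrier_vecI)
  have v1: "vnorm (col V k) = 1" if k: "k < n" for k
  proof -
    have "complex_of_real ((vnorm (col V k))\<^sup>2) = (1\<^sub>m n *\<^sub>v col V k) \<bullet>c col V k"
      using c by (simp only: one_mult_mat_vec cscalar_prod_self)
    also have "\<dots> = (mat_adjoint V * 1\<^sub>m n * V) $$ (k, k)"
      using k Vc by (subst sandwich_entry) auto
    also have "\<dots> = 1" using k V Vc by (simp add: unitary_left mult_one_dim)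
    finally have "(vnorm (col V k))\<^sup>2 = 1" by (simp only: of_real_eq_1_iff)
    thus ?thesis using vnorm_nonneg[of "col V k"] by (auto simp: power2_eq_1_iff)
  qed
  have vs: "vnorm (X *\<^sub>v col V k) = s k" if k: "k < n" for k
  proof -
    have "complex_of_real ((vnorm (X *\<^sub>v col V k))\<^sup>2) = (mat_adjoint X * X *\<^sub>v col V k) \<bullet>c col V k"
      using X c by (intro vnorm_mult_vec) auto
    also have "\<dots> = (mat_adjoint V * (mat_adjoint X * X) * V) $$ (k, k)"
      using k Vc X by (subst sandwich_entry) auto
    also have "\<dots> = complex_of_real ((s k)\<^sup>2)" unfolding d using k by simp
    finally have "(vnorm (X *\<^sub>v col V k))\<^sup>2 = (s k)\<^sup>2" by (simp only: of_real_eq_iff)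
    thus ?thesis using s[of k] by (simp add: power2_eq_iff_nonneg)
  qed
  have "mat_trace (C * X) = mat_trace (mat_adjoint V * (C * X) * V)"
    using V Cc X by (subst mat_trace_unitary) auto
  also have "\<dots> = (\<Sum>k<n. (C * X *\<^sub>v col V k) \<bullet>c col V k)"
    using Vc Cc X by (auto simp: mat_trace_def simp del: index_mult_mat(1) assoc_mult_mat_vec assoc_mult_mat
        intro!: sum.cong sandwich_entry)
  finally have "cmod (mat_trace (C * X)) \<le> (\<Sum>k<n. cmod ((C * X *\<^sub>v col V k) \<bullet>c col V k))"
    by (simp add: norm_sum)
  also have "\<dots> \<le> (\<Sum>k<n. s k)"
  proof (rule sum_mono)
    fix k assume "k \<in> {..<n}"
    hence k: "k < n" by simp
    have "cmod ((C * X *\<^sub>v col V k) \<bullet>c col V k) \<le> vnorm (C * X *\<^sub>v col V k) * vnorm (col V k)"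
      using Cc Vc by (intro cscalar_prod_le_vnorm) auto
    also have "\<dots> = vnorm (C *\<^sub>v (X *\<^sub>v col V k))"
      using Cc X c k by (simp add: v1 assoc_mult_mat_vec[of _ n n _ n])
    also have "\<dots> \<le> s k"
      using C XVk[of k] by (auto simp: contraction_def vs[OF k, symmetric])
    finally show "cmod ((C * X *\<^sub>v col V k) \<bullet>c col V k) \<le> s k" .
  qed
  finally show ?thesis by (simp add: tn)
qed

text \<open>The extremal contraction is the adjoint of the partial isometry in the polar
  decomposition. The columns of \<open>N\<close> are the normalised images of the right singular
  vectors, so \<open>N\<close> has a projection as its Gram matrix, and pairing it with
  \<open>X * V\<close> leaves the singular values on the diagonal.\<close>

theorem trace_norm_attained:
  assumes X: "X \<in> square_mats n"
  obtains C where "contraction n C" "mat_trace (C * X) = complex_of_real (trace_norm X)"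
proof -
  obtain V s where V: "unitary n V" and s: "\<And>i. (0::real) \<le> s i"
    and d: "mat_adjoint V * (mat_adjoint X * X) * V = mat_diag n (\<lambda>i. complex_of_real ((s i)\<^sup>2))"
    and tn: "trace_norm X = (\<Sum>i<n. s i)"
    using trace_norm_singular_values[OF X] by blast
  note dV [simp] = unitary_dim[OF V, THEN conjunct1] unitary_dim[OF V, THEN conjunct2]
  have dX [simp]: "dim_row X = n" "dim_col X = n" using X by auto
  \<comment> \<open>As \<open>inverse 0 = 0\<close>, this is the pseudo-inverse of the diagonal of
    singular values; the kernel of \<open>X\<close> is sent to 0 and needs no separate
    treatment.\<close>
  define R where "R = mat_diag n (\<lambda>i. complex_of_real (inverse (s i)))"
  have dR [simp]: "dim_row R = n" "dim_col R = n" by (auto simp: R_def)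
  define N where "N = X * V * R"
  have dN [simp]: "dim_row N = n" "dim_col N = n" by (auto simp: N_def)
  have Nc: "N \<in> square_mats n" by auto
  have adjN: "mat_adjoint N = R * mat_adjoint V * mat_adjoint X"
    by (simp add: N_def mat_adjoint_mult mult_assoc_dim) (simp add: R_def mat_adjoint_diag)
  have NXV: "mat_adjoint N * (X * V) = mat_diag n (\<lambda>i. complex_of_real (s i))"
  proof -
    have "mat_adjoint N * (X * V) = R * (mat_adjoint V * (mat_adjoint X * X) * V)"
      by (simp add: adjN mult_assoc_dim)
    also have "\<dots> = mat_diag n (\<lambda>i. complex_of_real (s i))"
      unfolding d R_def mat_diag_diag
    proof (intro arg_cong[of _ _ "mat_diag n"] ext)
      show "complex_of_real (inverse (s i)) * complex_of_real ((s i)\<^sup>2) = complex_of_real (s i)" for i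
        by (cases "s i = 0") (auto simp: power2_eq_square)
    qed
    finally show ?thesis .
  qed
  have NN: "mat_adjoint N * N = mat_diag n (\<lambda>i. if s i = 0 then 0 else 1)"
  proof -
    have "mat_adjoint N * N = mat_adjoint N * (X * V) * R"
      by (simp add: N_def mult_assoc_dim)
    also have "\<dots> = mat_diag n (\<lambda>i. if s i = 0 then 0 else 1)"
      unfolding NXV R_def mat_diag_diag
      by (intro arg_cong[of _ _ "mat_diag n"] ext) (auto simp flip: of_real_mult)
    finally show ?thesis .
  qed
  have "contraction n N"
    unfolding contraction_def
  proof (intro conjI ballI Nc)
    fix w :: "complex vec" assume w: "w \<in> carrier_vec n"
    have "complex_of_real ((vnorm (N *\<^sub>v w))\<^sup>2) = complex_of_real (\<Sum>k<n. if s k = 0 then 0 else (cmod (w $ k))\<^sup>2)"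
      using w unfolding vnorm_mult_vec[OF Nc w] NN
      by (auto simp: diag_mult_vec cscalar_prod_sum complex_norm_square intro!: sum.cong simp del: of_real_power)
    hence "(vnorm (N *\<^sub>v w))\<^sup>2 = (\<Sum>k<n. if s k = 0 then 0 else (cmod (w $ k))\<^sup>2)"
      by (simp only: of_real_eq_iff)
    also have "\<dots> \<le> (\<Sum>k<n. (cmod (w $ k))\<^sup>2)"
      by (intro sum_mono) auto
    also have "\<dots> = (vnorm w)\<^sup>2"
      using w by (simp add: vnorm_def L2_set_def sum_nonneg)
    finally show "vnorm (N *\<^sub>v w) \<le> vnorm w" by simp
  qed
  hence "contraction n (V * mat_adjoint N)"
    by (intro contraction_mult contraction_unitary[OF V] contraction_adjoint)
  moreover have "mat_trace (V * mat_adjoint N * X) = complex_of_real (trace_norm X)"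
  proof -
    have "mat_trace (V * (mat_adjoint N * X)) = mat_trace (mat_adjoint N * X * V)"
      by (rule mat_trace_mult_commute[OF unitary_carrier[OF V] mult_carrier_mat[OF mat_adjoint_carrier[OF Nc] X]])
    thus ?thesis by (simp add: mult_assoc_dim NXV mat_trace_diag tn)
  qed
  ultimately show ?thesis by (rule that)
qed

section \<open>Norm inequalities obtained by duality\<close>

lemma trace_norm_nonneg: "X \<in> square_mats n \<Longrightarrow> 0 \<le> trace_norm X"
  by (metis trace_norm_singular_values sum_nonneg)

lemma trace_norm_leI:
  assumes "X \<in> square_mats n" "\<And>C. contraction n C \<Longrightarrow> cmod (mat_trace (C * X)) \<le> b"
  shows "trace_norm X \<le> b"
  using trace_norm_attained[OF assms(1)] assms(2) trace_norm_nonneg[OF assms(1)]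
  by (metis abs_of_nonneg norm_of_real)

lemma trace_norm_triangle:
  assumes "X \<in> square_mats n" "Y \<in> square_mats n"
  shows "trace_norm (X + Y) \<le> trace_norm X + trace_norm Y"
proof (rule trace_norm_leI)
  fix C assume C: "contraction n C"
  have "mat_trace (C * (X + Y)) = mat_trace (C * X) + mat_trace (C * Y)"
    using assms contraction_carrier[OF C] by (simp add: mult_add_distrib_mat[of _ n n] mat_trace_add[of _ n])
  thus "cmod (mat_trace (C * (X + Y))) \<le> trace_norm X + trace_norm Y"
    using trace_norm_ge[OF C assms(1)] trace_norm_ge[OF C assms(2)] norm_triangle_ineq by smt
qed (use assms in auto)

lemma trace_norm_smult_le:
  assumes "X \<in> square_mats n"
  shows "trace_norm (a \<cdot>\<^sub>m X) \<le> cmod a * trace_norm X"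
proof (rule trace_norm_leI)
  fix C assume C: "contraction n C"
  have "mat_trace (C * (a \<cdot>\<^sub>m X)) = a * mat_trace (C * X)"
    using assms contraction_carrier[OF C] by (simp add: mult_smult_distrib[of _ n n] mat_trace_smult[of _ n])
  thus "cmod (mat_trace (C * (a \<cdot>\<^sub>m X))) \<le> cmod a * trace_norm X"
    using trace_norm_ge[OF C assms] by (simp add: norm_mult mult_left_mono)
qed (use assms in auto)

text \<open>Cyclicity of the trace moves the conjugation onto \<open>C\<close>, and a unitarily
  conjugated contraction is a contraction.\<close>

lemma trace_norm_unitary_le:
  assumes X: "X \<in> square_mats n" and U: "unitary n U"
  shows "trace_norm (U * X * mat_adjoint U) \<le> trace_norm X"
proof (rule trace_norm_leI)
  note dU [simp] = unitary_dim[OF U, THEN conjunct1] unitary_dim[OF U, THEN conjunct2]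
  fix C assume C: "contraction n C"
  have Cc: "C \<in> square_mats n" using C by (rule contraction_carrier)
  have "mat_trace (C * (U * X * mat_adjoint U)) = mat_trace (C * U * X * mat_adjoint U)"
    using X Cc by (auto simp: mult_assoc_dim)
  also have "\<dots> = mat_trace (mat_adjoint U * (C * U * X))"
    using X Cc unitary_carrier[OF U] by (intro mat_trace_mult_commute[of _ n n]) auto
  also have "\<dots> = mat_trace (mat_adjoint U * C * U * X)"
    using X Cc by (auto simp: mult_assoc_dim)
  also have "cmod \<dots> \<le> trace_norm X"
    by (intro trace_norm_ge[of n] X contraction_mult C contraction_unitary[OF U]
        contraction_unitary[OF unitary_adjoint[OF U]])
  finally show "cmod (mat_trace (C * (U * X * mat_adjoint U))) \<le> trace_norm X" .
qed (use X unitary_carrier[OF U] in auto)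

lemma trace_norm_ge_diag:
  assumes X: "X \<in> square_mats n"
  shows "(\<Sum>i<n. cmod (X $$ (i, i))) \<le> trace_norm X"
proof -
  \<comment> \<open>The conjugate phases of the diagonal entries; a vanishing entry gives 0 by the
    convention for division, which still has modulus at most 1.\<close>
  let ?C = "mat_diag n (\<lambda>i. complex_of_real (cmod (X $$ (i, i))) / X $$ (i, i))"
  have "mat_trace (?C * X) = (\<Sum>i<n. complex_of_real (cmod (X $$ (i, i))) / X $$ (i, i) * X $$ (i, i))"
    by (simp add: mat_diag_mult_left[OF X] mat_trace_def)
  also have "\<dots> = complex_of_real (\<Sum>i<n. cmod (X $$ (i, i)))"
    unfolding of_real_sum by (intro sum.cong) auto
  finally have "cmod (mat_trace (?C * X)) = (\<Sum>i<n. cmod (X $$ (i, i)))"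
    by (simp only: norm_of_real abs_of_nonneg sum_nonneg norm_ge_zero)
  moreover have "contraction n ?C" by (rule contraction_diag) (simp add: norm_divide)
  ultimately show ?thesis using trace_norm_ge[OF _ X, of ?C] by simp
qed

text \<open>A matrix unit is a contraction, and pairing with it reads off one entry. This controls
  the coefficients in the expansion that bounds linear maps.\<close>

lemma trace_norm_ge_entry:
  assumes X: "X \<in> square_mats n" and ij: "i < n" "j < n"
  shows "cmod (X $$ (i, j)) \<le> trace_norm X"
proof -
  have "mat_trace (mat_unit n j i * X) = (\<Sum>k<n. \<Sum>l<n. mat_unit n j i $$ (k, l) * X $$ (l, k))"
    using X by (simp add: mat_trace_def mat_unit_def index_mult_mat_sum del: index_mult_mat(1))
  also have "\<dots> = (\<Sum>k<n. if k = j then \<Sum>l<n. if l = i then X $$ (l, k) else 0 else 0)"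
    using ij by (intro sum.cong refl) (auto simp: mat_unit_def if_distrib[of "\<lambda>x. x * _"] cong: if_cong)
  also have "\<dots> = X $$ (i, j)" using ij by simp
  finally show ?thesis using trace_norm_ge[OF contraction_mat_unit[OF ij(2,1)] X] by simp
qed

subsection \<open>Kronecker products and tensor products of maps\<close>

lemma sum_lessThan_mult:
  fixes f :: "nat \<Rightarrow> 'a :: comm_monoid_add"
  shows "(\<Sum>r<m * n. f r) = (\<Sum>i<m. \<Sum>k<n. f (i * n + k))"
proof -
  have shift: "sum f {i * n..<i * n + n} = (\<Sum>k<n. f (i * n + k))" for i
    using sum.shift_bounds_nat_ivl[of f 0 "i * n" n] by (simp add: add.commute atLeast0LessThan)
  have "(\<Sum>r<m * n. f r) = (\<Sum>i<m. sum f {i * n..<i * n + n})"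
    by (rule sum.nat_group[symmetric])
  also have "\<dots> = (\<Sum>i<m. \<Sum>k<n. f (i * n + k))"
    by (simp only: shift)
  finally show ?thesis .
qed

lemma pair_index_less: "i < m \<Longrightarrow> k < n \<Longrightarrow> i * n + k < m * (n :: nat)"
proof -
  assume "i < m" "k < n"
  hence "i * n + k < (i + 1) * n" by simp
  also have "\<dots> \<le> m * n" using \<open>i < m\<close> by (intro mult_right_mono) auto
  finally show ?thesis .
qed

lemma div_mod_less: "r < m * n \<Longrightarrow> r div n < m \<and> r mod n < (n :: nat)"
  by (cases "n = 0") (auto simp: less_mult_imp_div_less)

lemma div_mod_inject: "r div n = c div n \<Longrightarrow> r mod n = c mod n \<Longrightarrow> r = (c :: nat)"
  by (metis div_mult_mod_eq)

lemma dim_kron [simp]: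
  "dim_row (kron A B) = dim_row A * dim_row B" "dim_col (kron A B) = dim_col A * dim_col B"
  by (auto simp: kron_def)

lemma kron_carrier [simp]:
  "A \<in> carrier_mat a b \<Longrightarrow> B \<in> carrier_mat p q \<Longrightarrow> kron A B \<in> carrier_mat (a * p) (b * q)"
  by auto

lemma index_kron:
  "r < dim_row A * dim_row B \<Longrightarrow> c < dim_col A * dim_col B \<Longrightarrow>
    kron A B $$ (r, c) = A $$ (r div dim_row B, c div dim_col B) * B $$ (r mod dim_row B, c mod dim_col B)"
  by (simp add: kron_def)

lemma kron_mult:
  assumes "A \<in> carrier_mat a b" "C \<in> carrier_mat b c" "B \<in> carrier_mat p q" "D \<in> carrier_mat q r"
  shows "kron A B * kron C D = kron (A * C) (B * D)"
proof (rule eq_matI)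
  fix x y assume "x < dim_row (kron (A * C) (B * D))" "y < dim_col (kron (A * C) (B * D))"
  hence xy: "x < a * p" "y < c * r" using assms by auto
  note dm = div_mod_less[OF xy(1)] div_mod_less[OF xy(2)]
  have "(kron A B * kron C D) $$ (x, y)
      = (\<Sum>i<b. \<Sum>k<q. kron A B $$ (x, i * q + k) * kron C D $$ (i * q + k, y))"
    using assms xy by (simp add: index_mult_mat_sum sum_lessThan_mult del: index_mult_mat(1))
  also have "\<dots> = (\<Sum>i<b. \<Sum>k<q. (A $$ (x div p, i) * C $$ (i, y div r)) * (B $$ (x mod p, k) * D $$ (k, y mod r)))"
    using assms xy by (intro sum.cong refl) (auto simp: index_kron pair_index_less)
  also have "\<dots> = kron (A * C) (B * D) $$ (x, y)"
    using assms xy dm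
    by (simp add: index_kron index_mult_mat_sum sum_product del: index_mult_mat(1))
  finally show "(kron A B * kron C D) $$ (x, y) = kron (A * C) (B * D) $$ (x, y)" .
qed (use assms in auto)

lemma mat_adjoint_kron: "mat_adjoint (kron A B) = kron (mat_adjoint A) (mat_adjoint B)"
  by (intro eq_matI) (auto simp: index_kron div_mod_less[THEN conjunct1] div_mod_less[THEN conjunct2])

lemma kron_one: "kron (1\<^sub>m m) (1\<^sub>m n) = 1\<^sub>m (m * n)"
proof (rule eq_matI)
  fix r c assume "r < dim_row (1\<^sub>m (m * n) :: complex mat)" "c < dim_col (1\<^sub>m (m * n) :: complex mat)"
  thus "kron (1\<^sub>m m) (1\<^sub>m n) $$ (r, c) = 1\<^sub>m (m * n) $$ (r, c)"
    using div_mod_less[of r m n] div_mod_less[of c m n]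
    by (auto simp: index_kron dest: div_mod_inject)
qed auto

lemma mat_trace_kron:
  assumes "A \<in> square_mats m" "B \<in> square_mats n"
  shows "mat_trace (kron A B) = mat_trace A * mat_trace B"
  using assms
  by (simp add: mat_trace_def sum_lessThan_mult index_kron pair_index_less sum_product)

lemma unitary_kron: "unitary m U \<Longrightarrow> unitary n V \<Longrightarrow> unitary (m * n) (kron U V)"
  by (simp add: unitary_def mat_adjoint_kron kron_mult[of _ m m _ m _ n n _ n] kron_one)

text \<open>Diagonalise both factors: the Kronecker product of the diagonal matrices is diagonal
  with the products of eigenvalues as entries.\<close>

lemma psd_kron:
  assumes A: "psd m A" and B: "psd n B"
  shows "psd (m * n) (kron A B)"
proof -
  obtain U s where U: "unitary m U" and s: "\<And>i. (0::real) \<le> s i"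
    and Ad: "A = U * mat_diag m (\<lambda>i. complex_of_real (s i)) * mat_adjoint U"
    using psd_spectral[OF A] by blast
  obtain V r where V: "unitary n V" and r: "\<And>i. (0::real) \<le> r i"
    and Bd: "B = V * mat_diag n (\<lambda>i. complex_of_real (r i)) * mat_adjoint V"
    using psd_spectral[OF B] by blast
  note c = unitary_carrier[OF U] unitary_carrier[OF V]
  have "kron A B = kron U V * kron (mat_diag m (\<lambda>i. complex_of_real (s i))) (mat_diag n (\<lambda>i. complex_of_real (r i)))
      * mat_adjoint (kron U V)"
    unfolding Ad Bd mat_adjoint_kron using c
    by (simp add: kron_mult[of _ m m _ m _ n n _ n])
  also have "kron (mat_diag m (\<lambda>i. complex_of_real (s i))) (mat_diag n (\<lambda>i. complex_of_real (r i)))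
      = mat_diag (m * n) (\<lambda>i. complex_of_real (s (i div n) * r (i mod n)))"
  proof (rule eq_matI)
    fix x y assume "x < dim_row (mat_diag (m * n) (\<lambda>i. complex_of_real (s (i div n) * r (i mod n))))"
      "y < dim_col (mat_diag (m * n) (\<lambda>i. complex_of_real (s (i div n) * r (i mod n))))"
    thus "kron (mat_diag m (\<lambda>i. complex_of_real (s i))) (mat_diag n (\<lambda>i. complex_of_real (r i))) $$ (x, y)
      = mat_diag (m * n) (\<lambda>i. complex_of_real (s (i div n) * r (i mod n))) $$ (x, y)"
      using div_mod_less[of x m n] div_mod_less[of y m n]
      by (auto simp: index_kron dest: div_mod_inject)
  qed auto
  also have "psd (m * n) (kron U V * \<dots> * mat_adjoint (kron U V))"
    using c s r by (intro psd_congruence[of "m * n"] psd_diag) auto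
  finally show ?thesis .
qed

section \<open>Matrix units and boundedness of linear maps\<close>

lemma mat_sum_carrier [simp]: "mat_sum n F I \<in> square_mats n"
  by (simp add: mat_sum_def)

lemma mat_sum_empty: "mat_sum n F {} = 0\<^sub>m n n"
  by (intro eq_matI) (auto simp: mat_sum_def)

lemma mat_sum_insert:
  assumes "finite I" "x \<notin> I" "F x \<in> square_mats n"
  shows "mat_sum n F (insert x I) = F x + mat_sum n F I"
  using assms by (intro eq_matI) (auto simp: mat_sum_def)

lemma mat_sum_cong: "(\<And>x. x \<in> I \<Longrightarrow> F x = G x) \<Longrightarrow> mat_sum n F I = mat_sum n G I"
  by (simp add: mat_sum_def)

lemma mat_unit_carrier [simp]: "mat_unit n i j \<in> square_mats n"
  by (simp add: mat_unit_def)

lemma mat_unit_expansion: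
  assumes "X \<in> square_mats n"
  shows "X = mat_sum n (\<lambda>(i, j). X $$ (i, j) \<cdot>\<^sub>m mat_unit n i j) ({..<n} \<times> {..<n})"
proof (rule eq_matI)
  let ?Y = "mat_sum n (\<lambda>(i, j). X $$ (i, j) \<cdot>\<^sub>m mat_unit n i j) ({..<n} \<times> {..<n})"
  fix r c assume "r < dim_row ?Y" "c < dim_col ?Y"
  hence rc: "r < n" "c < n" by (auto simp: mat_sum_def)
  hence "?Y $$ (r, c) = (\<Sum>p\<in>{..<n} \<times> {..<n}. (case p of (i, j) \<Rightarrow> X $$ (i, j) \<cdot>\<^sub>m mat_unit n i j) $$ (r, c))"
    by (simp add: mat_sum_def)
  also have "\<dots> = (\<Sum>p\<in>{..<n} \<times> {..<n}. if p = (r, c) then X $$ (r, c) else 0)"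
    using rc by (intro sum.cong refl) (auto simp: mat_unit_def split: if_splits)
  finally show "X $$ (r, c) = ?Y $$ (r, c)" using rc by simp
qed (use assms in \<open>auto simp: mat_sum_def\<close>)

lemma linear_map_carrier: "linear_map n F \<Longrightarrow> X \<in> square_mats n \<Longrightarrow> F X \<in> square_mats n"
  by (simp add: linear_map_def)

lemma linear_map_add:
  "linear_map n F \<Longrightarrow> X \<in> square_mats n \<Longrightarrow> Y \<in> square_mats n \<Longrightarrow> F (X + Y) = F X + F Y"
  by (simp add: linear_map_def)

lemma linear_map_smult:
  "linear_map n F \<Longrightarrow> X \<in> square_mats n \<Longrightarrow> F (a \<cdot>\<^sub>m X) = a \<cdot>\<^sub>m F X"
  by (simp add: linear_map_def)

lemma linear_map_zero:
  assumes "linear_map n F"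
  shows "F (0\<^sub>m n n) = 0\<^sub>m n n"
proof -
  have "0 \<cdot>\<^sub>m Y = 0\<^sub>m n n" if "Y \<in> square_mats n" for Y :: "complex mat"
    using that by (intro eq_matI) auto
  thus ?thesis
    using linear_map_smult[OF assms, of "0\<^sub>m n n" 0] linear_map_carrier[OF assms, of "0\<^sub>m n n"] by simp
qed

lemma linear_map_id: "linear_map n id"
  by (simp add: linear_map_def)

lemma linear_map_comp: "linear_map n F \<Longrightarrow> linear_map n G \<Longrightarrow> linear_map n (\<lambda>X. F (G X))"
  by (simp add: linear_map_def)

lemma linear_map_congruence:
  "U \<in> square_mats n \<Longrightarrow> V \<in> square_mats n \<Longrightarrow> linear_map n (\<lambda>X. U * X * V)"
  by (simp add: linear_map_def mult_add_distrib_mat[of _ n n] add_mult_distrib_mat[of _ n n]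
      mult_smult_distrib[of _ n n] mult_smult_assoc_mat[of _ n n])

lemma linear_map_mat_sum:
  assumes F: "linear_map n F" and "finite I" "\<And>x. x \<in> I \<Longrightarrow> G x \<in> square_mats n"
  shows "F (mat_sum n G I) = mat_sum n (\<lambda>x. F (G x)) I"
  using assms(2,3)
proof (induction I rule: finite_induct)
  case empty
  show ?case by (simp add: mat_sum_empty linear_map_zero[OF F])
next
  case (insert x I)
  thus ?case using linear_map_carrier[OF F, of "G x"]
    by (simp add: mat_sum_insert linear_map_add[OF F])
qed

lemma linear_map_expansion:
  assumes F: "linear_map n F" and X: "X \<in> square_mats n"
  shows "F X = mat_sum n (\<lambda>(i, j). X $$ (i, j) \<cdot>\<^sub>m F (mat_unit n i j)) ({..<n} \<times> {..<n})"
proof -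
  have "F X = F (mat_sum n (\<lambda>(i, j). X $$ (i, j) \<cdot>\<^sub>m mat_unit n i j) ({..<n} \<times> {..<n}))"
    using mat_unit_expansion[OF X] by simp
  also have "\<dots> = mat_sum n (\<lambda>p. F ((\<lambda>(i, j). X $$ (i, j) \<cdot>\<^sub>m mat_unit n i j) p)) ({..<n} \<times> {..<n})"
    by (intro linear_map_mat_sum F) auto
  also have "\<dots> = mat_sum n (\<lambda>(i, j). X $$ (i, j) \<cdot>\<^sub>m F (mat_unit n i j)) ({..<n} \<times> {..<n})"
    by (intro mat_sum_cong) (auto simp: linear_map_smult[OF F])
  finally show ?thesis .
qed

lemma trace_norm_mat_sum_le:
  assumes "finite I" "\<And>x. x \<in> I \<Longrightarrow> G x \<in> square_mats n"
  shows "trace_norm (mat_sum n G I) \<le> (\<Sum>x\<in>I. trace_norm (G x))"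
  using assms
proof (induction I rule: finite_induct)
  case empty
  have "trace_norm (0 \<cdot>\<^sub>m 0\<^sub>m n n) \<le> cmod 0 * trace_norm (0\<^sub>m n n)"
    by (rule trace_norm_smult_le[of _ n]) simp
  thus ?case by (simp add: mat_sum_empty)
next
  case (insert x I)
  have "trace_norm (G x + mat_sum n G I) \<le> trace_norm (G x) + trace_norm (mat_sum n G I)"
    using insert by (intro trace_norm_triangle[of _ n]) auto
  thus ?case using insert by (simp add: mat_sum_insert)
qed

text \<open>Every coefficient in the expansion of \<open>X\<close> in matrix units is at most its
  trace norm, so the sum of the norms of the images of the matrix units serves as \<open>K\<close>.
  The witness stays schematic until the last line fixes it.\<close>

lemma linear_map_bounded:
  assumes F: "linear_map n F"
  shows "\<exists>K. \<forall>X\<in>square_mats n. trace_norm (F X) \<le> K * trace_norm X"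
proof (rule exI, rule ballI)
  let ?I = "{..<n} \<times> {..<n}" and ?E = "\<lambda>(i, j). F (mat_unit n i j)"
  fix X assume X: "X \<in> square_mats n"
  have Ec: "?E p \<in> square_mats n" for p using linear_map_carrier[OF F] by (cases p) auto
  have "trace_norm (F X) = trace_norm (mat_sum n (\<lambda>p. X $$ p \<cdot>\<^sub>m ?E p) ?I)"
    unfolding linear_map_expansion[OF F X] by (intro arg_cong[of _ _ trace_norm] mat_sum_cong) auto
  also have "\<dots> \<le> (\<Sum>p\<in>?I. trace_norm (X $$ p \<cdot>\<^sub>m ?E p))"
    using Ec by (intro trace_norm_mat_sum_le) auto
  also have "\<dots> \<le> (\<Sum>p\<in>?I. trace_norm X * trace_norm (?E p))"
  proof (rule sum_mono)
    fix p assume p: "p \<in> ?I"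
    have "trace_norm (X $$ p \<cdot>\<^sub>m ?E p) \<le> cmod (X $$ p) * trace_norm (?E p)"
      by (rule trace_norm_smult_le[OF Ec])
    also have "\<dots> \<le> trace_norm X * trace_norm (?E p)"
      using p trace_norm_ge_entry[OF X] trace_norm_nonneg[OF Ec]
      by (intro mult_right_mono) auto
    finally show "trace_norm (X $$ p \<cdot>\<^sub>m ?E p) \<le> trace_norm X * trace_norm (?E p)" .
  qed
  finally show "trace_norm (F X) \<le> (\<Sum>p\<in>?I. trace_norm (?E p)) * trace_norm X"
    by (simp add: sum_distrib_left mult.commute)
qed

lemma kron_mat_unit:
  assumes "r < m * n" "c < m * n"
  shows "kron (mat_unit m (r div n) (c div n)) (mat_unit n (r mod n) (c mod n)) = mat_unit (m * n) r c"
proof (rule eq_matI)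
  fix x y assume "x < dim_row (mat_unit (m * n) r c)" "y < dim_col (mat_unit (m * n) r c)"
  hence xy: "x < m * n" "y < m * n" by (auto simp: mat_unit_def)
  have "x div n = r div n \<and> x mod n = r mod n \<longleftrightarrow> x = r" "y div n = c div n \<and> y mod n = c mod n \<longleftrightarrow> y = c"
    by (metis div_mult_mod_eq)+
  thus "kron (mat_unit m (r div n) (c div n)) (mat_unit n (r mod n) (c mod n)) $$ (x, y) = mat_unit (m * n) r c $$ (x, y)"
    using xy div_mod_less[OF xy(1)] div_mod_less[OF xy(2)] by (auto simp: index_kron mat_unit_def)
qed (auto simp: mat_unit_def)

text \<open>Kronecker products span, since every matrix unit of the large algebra is one. The scalar
  belongs to the base case so that a term of the matrix-unit expansion fits it directly; addition is
  then the only inductive step.\<close>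

lemma kron_induct [consumes 1, case_names add kron]:
  assumes X: "X \<in> square_mats (m * n)"
    and add: "\<And>X Y. X \<in> square_mats (m * n) \<Longrightarrow> Y \<in> square_mats (m * n) \<Longrightarrow> P X \<Longrightarrow> P Y \<Longrightarrow> P (X + Y)"
    and kron: "\<And>a A B. A \<in> square_mats m \<Longrightarrow> B \<in> square_mats n \<Longrightarrow> P (a \<cdot>\<^sub>m kron A B)"
  shows "P X"
proof -
  have "P (mat_sum (m * n) (\<lambda>(r, c). X $$ (r, c) \<cdot>\<^sub>m mat_unit (m * n) r c) I)"
    if "finite I" "I \<subseteq> {..<m * n} \<times> {..<m * n}" for I
    using that
  proof (induction I rule: finite_induct)
    case empty
    have "0\<^sub>m (m * n) (m * n) = (0 :: complex) \<cdot>\<^sub>m kron (0\<^sub>m m m) (0\<^sub>m n n)"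
      by (intro eq_matI) auto
    thus ?case using kron[of "0\<^sub>m m m" "0\<^sub>m n n" 0] by (simp add: mat_sum_empty)
  next
    case (insert p I)
    obtain r c where p: "p = (r, c)" by (cases p)
    have "P (X $$ (r, c) \<cdot>\<^sub>m mat_unit (m * n) r c)"
      using insert.prems p kron_mat_unit[of r m n c]
        kron[of "mat_unit m (r div n) (c div n)" "mat_unit n (r mod n) (c mod n)" "X $$ (r, c)"] by simp
    thus ?case using insert p by (simp add: mat_sum_insert add)
  qed
  from this[of "{..<m * n} \<times> {..<m * n}"] show ?thesis
    using mat_unit_expansion[OF X] by simp
qed

lemma linear_map_eq_on_kron:
  assumes F: "linear_map (m * n) F" and G: "linear_map (m * n) G"
    and eq: "\<And>A B. A \<in> square_mats m \<Longrightarrow> B \<in> square_mats n \<Longrightarrow> F (kron A B) = G (kron A B)"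
    and X: "X \<in> square_mats (m * n)"
  shows "F X = G X"
  using X
  by (induction rule: kron_induct)
    (simp_all add: linear_map_add[OF F] linear_map_add[OF G] linear_map_smult[OF F] linear_map_smult[OF G] eq)

text \<open>The definition expands its argument in matrix units, so linearity in it is built in.
  Linearity of the factors matters first when a product is evaluated.\<close>

lemma linear_map_map_tensor: "linear_map (m * n) (map_tensor m n \<Phi> \<Psi>)"
  unfolding linear_map_def
proof (intro conjI ballI allI)
  fix X Y :: "complex mat" and a :: complex
  assume XY: "X \<in> square_mats (m * n)" "Y \<in> square_mats (m * n)"
  show "map_tensor m n \<Phi> \<Psi> (X + Y) = map_tensor m n \<Phi> \<Psi> X + map_tensor m n \<Phi> \<Psi> Y"
    using XY by (intro eq_matI)
      (auto simp: map_tensor_def pair_index_less distrib_right sum.distrib intro!: sum.cong)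
next
  fix X :: "complex mat" and a :: complex
  assume X: "X \<in> square_mats (m * n)"
  show "map_tensor m n \<Phi> \<Psi> (a \<cdot>\<^sub>m X) = a \<cdot>\<^sub>m map_tensor m n \<Phi> \<Psi> X"
    using X by (intro eq_matI)
      (auto simp: map_tensor_def pair_index_less sum_distrib_left mult.assoc intro!: sum.cong)
qed (simp add: map_tensor_def)

text \<open>The fourfold sum splits into the coordinate expansions of \<open>\<Phi> A\<close> and
  \<open>\<Psi> B\<close>. This identifies the formula in matrix units as the tensor product of the
  maps.\<close>

lemma map_tensor_kron:
  assumes \<Phi>: "linear_map m \<Phi>" and \<Psi>: "linear_map n \<Psi>"
    and A: "A \<in> square_mats m" and B: "B \<in> square_mats n"
  shows "map_tensor m n \<Phi> \<Psi> (kron A B) = kron (\<Phi> A) (\<Psi> B)"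
proof (rule eq_matI)
  note c = linear_map_carrier[OF \<Phi>] linear_map_carrier[OF \<Psi>]
  fix x y assume "x < dim_row (kron (\<Phi> A) (\<Psi> B))" "y < dim_col (kron (\<Phi> A) (\<Psi> B))"
  hence xy: "x < m * n" "y < m * n" using c(1)[OF A] c(2)[OF B] by auto
  note dm = div_mod_less[OF xy(1)] div_mod_less[OF xy(2)]
  have kr: "kron (\<Phi> P) (\<Psi> Q) $$ (x, y) = \<Phi> P $$ (x div n, y div n) * \<Psi> Q $$ (x mod n, y mod n)"
    if "P \<in> square_mats m" "Q \<in> square_mats n" for P Q
    using c(1)[OF that(1)] c(2)[OF that(2)] xy by (auto simp: index_kron)
  have e: "F X $$ (u, v) = (\<Sum>i<d. \<Sum>j<d. X $$ (i, j) * F (mat_unit d i j) $$ (u, v))"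
    if "linear_map d F" "X \<in> square_mats d" "u < d" "v < d" for d F X u v
  proof -
    have "F (mat_unit d i j) \<in> square_mats d" for i j using that by (simp add: linear_map_carrier)
    hence "dim_row (F (mat_unit d i j)) = d \<and> dim_col (F (mat_unit d i j)) = d" for i j by auto
    thus ?thesis
      by (subst linear_map_expansion[OF that(1,2)])
        (use that in \<open>simp add: mat_sum_def sum.cartesian_product split_beta\<close>)
  qed
  have "map_tensor m n \<Phi> \<Psi> (kron A B) $$ (x, y)
      = (\<Sum>i<m. \<Sum>j<m. \<Sum>k<n. \<Sum>l<n. (A $$ (i, j) * \<Phi> (mat_unit m i j) $$ (x div n, y div n))
          * (B $$ (k, l) * \<Psi> (mat_unit n k l) $$ (x mod n, y mod n)))"
    using xy A B by (auto simp: map_tensor_def index_kron[of _ A B] pair_index_less kr intro!: sum.cong)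
  also have "\<dots> = \<Phi> A $$ (x div n, y div n) * \<Psi> B $$ (x mod n, y mod n)"
    unfolding e[OF \<Phi> A conjunct1[OF dm(1)] conjunct1[OF dm(2)]] e[OF \<Psi> B conjunct2[OF dm(1)] conjunct2[OF dm(2)]]
    by (simp only: sum_distrib_right) (simp only: sum_distrib_left)
  finally show "map_tensor m n \<Phi> \<Psi> (kron A B) $$ (x, y) = kron (\<Phi> A) (\<Psi> B) $$ (x, y)"
    by (simp add: kr[OF A B])
qed (use linear_map_carrier[OF \<Phi> A] linear_map_carrier[OF \<Psi> B] in \<open>auto simp: map_tensor_def\<close>)

text \<open>The composites are described by maps that agree with them on the small algebras. This is
  the form in which divisibility is given, as an equation on matrices of size \<open>d\<close>
  rather than between total functions.\<close>

lemma map_tensor_comp: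
  assumes "linear_map m \<Phi>" "linear_map n \<Psi>" "linear_map m \<Phi>'" "linear_map n \<Psi>'"
    and "linear_map m \<Theta>" "\<And>A. A \<in> square_mats m \<Longrightarrow> \<Theta> A = \<Phi> (\<Phi>' A)"
    and "linear_map n \<Xi>" "\<And>A. A \<in> square_mats n \<Longrightarrow> \<Xi> A = \<Psi> (\<Psi>' A)"
    and X: "X \<in> square_mats (m * n)"
  shows "map_tensor m n \<Phi> \<Psi> (map_tensor m n \<Phi>' \<Psi>' X) = map_tensor m n \<Theta> \<Xi> X"
proof (rule linear_map_eq_on_kron[OF _ linear_map_map_tensor _ X])
  show "linear_map (m * n) (\<lambda>X. map_tensor m n \<Phi> \<Psi> (map_tensor m n \<Phi>' \<Psi>' X))"
    by (rule linear_map_comp[OF linear_map_map_tensor linear_map_map_tensor])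
qed (use assms in \<open>simp add: map_tensor_kron linear_map_carrier\<close>)

lemma map_tensor_trace:
  assumes "linear_map m \<Phi>" "linear_map n \<Psi>" "trace_preserving m \<Phi>" "trace_preserving n \<Psi>"
    and X: "X \<in> square_mats (m * n)"
  shows "mat_trace (map_tensor m n \<Phi> \<Psi> X) = mat_trace X"
  using X
proof (induction rule: kron_induct)
  case (add X Y)
  thus ?case
    by (simp add: linear_map_add[OF linear_map_map_tensor] mat_trace_add[of _ "m * n"]
        linear_map_carrier[OF linear_map_map_tensor])
next
  case (kron a A B)
  thus ?case using assms
    by (simp add: linear_map_smult[OF linear_map_map_tensor] map_tensor_kron mat_trace_smult[of _ "m * n"]
        mat_trace_kron[of _ m _ n] linear_map_carrier trace_preserving_def)
qed

subsection \<open>The swap\<close>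

text \<open>The flip of the two tensor factors: it exchanges quotient and remainder of the index
  modulo \<open>d\<close>.\<close>

definition swap_mat :: "nat \<Rightarrow> complex mat" where
  "swap_mat d = mat (d * d) (d * d) (\<lambda>(r, c). if c = r mod d * d + r div d then 1 else 0)"

lemma swap_mat_carrier [simp]: "swap_mat d \<in> square_mats (d * d)"
  by (simp add: swap_mat_def)

lemma swap_index_less: "r < d * d \<Longrightarrow> r mod d * d + r div d < d * (d :: nat)"
  using div_mod_less[of r d d] by (simp add: pair_index_less)

lemma index_swap_mult:
  assumes "dim_row X = d * d" "r < d * d" "c < dim_col X"
  shows "(swap_mat d * X) $$ (r, c) = X $$ (r mod d * d + r div d, c)"
  using assms swap_index_less[OF assms(2)]
  by (simp add: swap_mat_def index_mult_mat_sum if_distrib[of "\<lambda>x. x * _"] cong: if_cong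
      del: index_mult_mat(1))

lemma index_mult_swap:
  assumes "dim_col X = d * d" "r < dim_row X" "c < d * d"
  shows "(X * mat_adjoint (swap_mat d)) $$ (r, c) = X $$ (r, c mod d * d + c div d)"
  using assms swap_index_less[OF assms(3)]
  by (simp add: swap_mat_def index_mult_mat_sum if_distrib[of cnj] if_distrib[of "\<lambda>x. _ * x"] cong: if_cong
      del: index_mult_mat(1))

lemma swap_index_div_mod:
  assumes "r < d * d"
  shows "(r mod d * d + r div d) div d = r mod d" "(r mod d * d + r div d) mod d = r div (d :: nat)"
proof -
  have "r div d < d" using div_mod_less[OF assms] by simp
  thus "(r mod d * d + r div d) div d = r mod d" "(r mod d * d + r div d) mod d = r div d"
    by auto
qed

lemma unitary_swap: "unitary (d * d) (swap_mat d)"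
proof -
  have "swap_mat d * mat_adjoint (swap_mat d) = 1\<^sub>m (d * d)"
  proof (rule eq_matI)
    fix r c assume "r < dim_row (1\<^sub>m (d * d) :: complex mat)" "c < dim_col (1\<^sub>m (d * d) :: complex mat)"
    hence rc: "r < d * d" "c < d * d" by auto
    have "r = c" if "r mod d * d + r div d = c mod d * d + c div d"
      using swap_index_div_mod[OF rc(1)] swap_index_div_mod[OF rc(2)] that
      by (intro div_mod_inject[of r d c]) auto
    thus "(swap_mat d * mat_adjoint (swap_mat d)) $$ (r, c) = 1\<^sub>m (d * d) $$ (r, c)"
      using rc swap_index_less[OF rc(2)]
      by (subst index_mult_swap) (auto simp: swap_mat_def)
  qed (auto simp: swap_mat_def)
  thus ?thesis
    using mat_mult_left_right_inverse[of "swap_mat d" "d * d" "mat_adjoint (swap_mat d)"]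
    by (simp add: unitary_def)
qed

lemma swap_kron:
  assumes "A \<in> square_mats d" "B \<in> square_mats d"
  shows "swap_mat d * kron A B * mat_adjoint (swap_mat d) = kron B A"
proof (rule eq_matI)
  fix r c assume "r < dim_row (kron B A)" "c < dim_col (kron B A)"
  hence rc: "r < d * d" "c < d * d" using assms by auto
  note l = swap_index_less[OF rc(1)] swap_index_less[OF rc(2)]
  have S: "dim_row (swap_mat d) = d * d" by (simp add: swap_mat_def)
  have "(swap_mat d * kron A B * mat_adjoint (swap_mat d)) $$ (r, c)
      = (swap_mat d * kron A B) $$ (r, c mod d * d + c div d)"
    using rc assms S by (intro index_mult_swap) auto
  also have "\<dots> = kron A B $$ (r mod d * d + r div d, c mod d * d + c div d)"
    using rc assms l by (intro index_swap_mult) auto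
  also have "\<dots> = kron B A $$ (r, c)"
    using rc assms l swap_index_div_mod[OF rc(1)] swap_index_div_mod[OF rc(2)]
    by (simp add: index_kron)
  finally show "(swap_mat d * kron A B * mat_adjoint (swap_mat d)) $$ (r, c) = kron B A $$ (r, c)" .
qed (use assms in \<open>auto simp: swap_mat_def\<close>)

text \<open>The flip is its own inverse, so one and the same conjugation stands before and after the
  map. The identity transports both norm bounds and positivity from the first factor to the
  second.\<close>

lemma map_tensor_id_swap:
  assumes \<Psi>: "linear_map d \<Psi>" and X: "X \<in> square_mats (d * d)"
  shows "map_tensor d d id \<Psi> X
    = swap_mat d * map_tensor d d \<Psi> id (swap_mat d * X * mat_adjoint (swap_mat d)) * mat_adjoint (swap_mat d)"
proof (rule linear_map_eq_on_kron[OF linear_map_map_tensor _ _ X])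
  have L: "linear_map (d * d) (\<lambda>X. swap_mat d * X * mat_adjoint (swap_mat d))"
    by (rule linear_map_congruence) auto
  show "linear_map (d * d) (\<lambda>X. swap_mat d * map_tensor d d \<Psi> id
      (swap_mat d * X * mat_adjoint (swap_mat d)) * mat_adjoint (swap_mat d))"
    by (rule linear_map_comp[OF L linear_map_comp[OF linear_map_map_tensor L]])
next
  fix A B :: "complex mat" assume AB: "A \<in> square_mats d" "B \<in> square_mats d"
  show "map_tensor d d id \<Psi> (kron A B) = swap_mat d * map_tensor d d \<Psi> id
      (swap_mat d * kron A B * mat_adjoint (swap_mat d)) * mat_adjoint (swap_mat d)"
    unfolding swap_kron[OF AB] map_tensor_kron[OF linear_map_id \<Psi> AB]
      map_tensor_kron[OF \<Psi> linear_map_id AB(2,1)] id_apply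
    using AB by (simp add: swap_kron linear_map_carrier[OF \<Psi>])
qed

subsection \<open>The diamond norm\<close>

text \<open>Membership in the set bounds an element by its supremum only if the set is bounded
  above, which \<open>linear_map_bounded\<close> provides. Homogeneity then extends the bound from
  the unit ball to all operators.\<close>

lemma
  assumes \<Phi>: "linear_map d \<Phi>"
  shows diamond_norm_nonneg: "0 \<le> diamond_norm d \<Phi>"
    and trace_norm_map_tensor_id_le: "Z \<in> square_mats (d * d) \<Longrightarrow>
      trace_norm (map_tensor d d \<Phi> id Z) \<le> diamond_norm d \<Phi> * trace_norm Z"
proof -
  let ?F = "map_tensor d d \<Phi> id"
  let ?S = "{trace_norm (?F X) | X. X \<in> square_mats (d * d) \<and> trace_norm X \<le> 1}"
  have F: "linear_map (d * d) ?F" by (rule linear_map_map_tensor)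
  obtain K where K: "\<And>X. X \<in> square_mats (d * d) \<Longrightarrow> trace_norm (?F X) \<le> K * trace_norm X"
    using linear_map_bounded[OF F] by blast
  have bdd: "bdd_above ?S"
  proof (rule bdd_aboveI)
    fix x assume "x \<in> ?S"
    then obtain X where X: "X \<in> square_mats (d * d)" "trace_norm X \<le> 1" "x = trace_norm (?F X)" by blast
    have "x \<le> K * trace_norm X" using K X by simp
    also have "\<dots> \<le> \<bar>K\<bar> * 1"
      using X trace_norm_nonneg[OF X(1)] by (intro mult_mono) auto
    finally show "x \<le> \<bar>K\<bar>" by simp
  qed
  have upper: "trace_norm (?F X) \<le> diamond_norm d \<Phi>" if "X \<in> square_mats (d * d)" "trace_norm X \<le> 1" for X
    unfolding diamond_norm_def using that bdd by (intro cSup_upper) auto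
  \<comment> \<open>The zero matrix lies in the unit ball, so the supremum dominates a norm and is
    nonnegative.\<close>
  have "trace_norm (0\<^sub>m (d * d) (d * d)) \<le> 0"
    using trace_norm_mat_sum_le[of "{}" "\<lambda>_. 0\<^sub>m (d * d) (d * d)" "d * d"] by (simp add: mat_sum_empty)
  from upper[of "0\<^sub>m (d * d) (d * d)"] this show "0 \<le> diamond_norm d \<Phi>"
    using trace_norm_nonneg[OF linear_map_carrier[OF F], of "0\<^sub>m (d * d) (d * d)"] by simp
  show "trace_norm (?F Z) \<le> diamond_norm d \<Phi> * trace_norm Z" if Z: "Z \<in> square_mats (d * d)"
  proof (cases "trace_norm Z = 0")
    case True
    \<comment> \<open>An operator of norm 0 cannot be normalised, but the crude bound forces its
      image to have norm 0.\<close>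
    thus ?thesis using K[OF Z] by simp
  next
    case False
    define t where "t = trace_norm Z"
    have t: "t > 0" using False trace_norm_nonneg[OF Z] by (simp add: t_def)
    define Y where "Y = complex_of_real (1 / t) \<cdot>\<^sub>m Z"
    have Y: "Y \<in> square_mats (d * d)" using Z by (simp add: Y_def)
    have "trace_norm Y \<le> 1"
      using trace_norm_smult_le[OF Z, of "complex_of_real (1 / t)"] t by (simp add: Y_def norm_divide t_def)
    have ZY: "Z = complex_of_real t \<cdot>\<^sub>m Y"
      using t Z by (intro eq_matI) (auto simp: Y_def)
    have "trace_norm (?F Z) = trace_norm (complex_of_real t \<cdot>\<^sub>m ?F Y)"
      unfolding ZY linear_map_smult[OF F Y] ..
    also have "\<dots> \<le> t * trace_norm (?F Y)"
      using trace_norm_smult_le[OF linear_map_carrier[OF F Y], of "complex_of_real t"] t by simp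
    also have "\<dots> \<le> t * diamond_norm d \<Phi>"
      using upper[OF Y \<open>trace_norm Y \<le> 1\<close>] t by simp
    finally show ?thesis by (simp add: t_def mult.commute)
  qed
qed

lemma trace_norm_id_map_tensor_le:
  assumes \<Psi>: "linear_map d \<Psi>" and Z: "Z \<in> square_mats (d * d)"
  shows "trace_norm (map_tensor d d id \<Psi> Z) \<le> diamond_norm d \<Psi> * trace_norm Z"
proof -
  let ?S = "swap_mat d"
  have SZ: "?S * Z * mat_adjoint ?S \<in> square_mats (d * d)"
    using Z swap_mat_carrier[of d] by (intro mult_carrier_mat mat_adjoint_carrier)
  have "trace_norm (map_tensor d d id \<Psi> Z) \<le> trace_norm (map_tensor d d \<Psi> id (?S * Z * mat_adjoint ?S))"
    unfolding map_tensor_id_swap[OF \<Psi> Z]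
    by (intro trace_norm_unitary_le[OF _ unitary_swap] linear_map_carrier[OF linear_map_map_tensor] SZ)
  also have "\<dots> \<le> diamond_norm d \<Psi> * trace_norm (?S * Z * mat_adjoint ?S)"
    by (rule trace_norm_map_tensor_id_le[OF \<Psi> SZ])
  also have "\<dots> \<le> diamond_norm d \<Psi> * trace_norm Z"
    by (intro mult_left_mono trace_norm_unitary_le[OF Z unitary_swap] diamond_norm_nonneg[OF \<Psi>])
  finally show ?thesis .
qed

lemma trace_norm_map_tensor_le:
  assumes \<Phi>: "linear_map d \<Phi>" and Z: "Z \<in> square_mats (d * d)"
  shows "trace_norm (map_tensor d d \<Phi> \<Phi> Z) \<le> (diamond_norm d \<Phi>)\<^sup>2 * trace_norm Z"
proof -
  have "map_tensor d d \<Phi> \<Phi> Z = map_tensor d d \<Phi> id (map_tensor d d id \<Phi> Z)"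
    using \<Phi> linear_map_id Z by (intro map_tensor_comp[symmetric]) auto
  also have "trace_norm \<dots> \<le> diamond_norm d \<Phi> * trace_norm (map_tensor d d id \<Phi> Z)"
    by (intro trace_norm_map_tensor_id_le[OF \<Phi>] linear_map_carrier[OF linear_map_map_tensor] Z)
  also have "\<dots> \<le> diamond_norm d \<Phi> * (diamond_norm d \<Phi> * trace_norm Z)"
    by (intro mult_left_mono trace_norm_id_map_tensor_le[OF \<Phi> Z] diamond_norm_nonneg[OF \<Phi>])
  finally show ?thesis by (simp add: power2_eq_square mult.assoc)
qed

subsection \<open>Projective measurements\<close>

text \<open>The pinching in the basis formed by the columns of \<open>U\<close>: rotate, keep the
  diagonal, rotate back. A single unitary encodes the basis, so a product basis is simply a
  Kronecker product of unitaries.\<close>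

definition measure_in :: "nat \<Rightarrow> complex mat \<Rightarrow> complex mat \<Rightarrow> complex mat" where
  "measure_in n U X = U * mat_diag n (\<lambda>i. (mat_adjoint U * X * U) $$ (i, i)) * mat_adjoint U"

lemma index_mult_diag_adjoint:
  assumes U: "U \<in> square_mats n" and rc: "r < n" "c < n"
  shows "(U * mat_diag n s * mat_adjoint U) $$ (r, c) = (\<Sum>i<n. U $$ (r, i) * s i * cnj (U $$ (c, i)))"
  unfolding mat_diag_mult_right[OF U]
  using U rc by (subst index_mult_mat_sum) auto

lemma rank_one_measurementE:
  assumes "rank_one_measurement n P"
  obtains U where "unitary n U" "\<And>X. X \<in> square_mats n \<Longrightarrow> P X = measure_in n U X"
proof -
  obtain b where b: "orthonormal_basis n b"
    and P: "P = (\<lambda>X. mat_sum n (\<lambda>i. ket_bra (b i) * X * ket_bra (b i)) {..<n})"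
    using assms by (auto simp: rank_one_measurement_def)
  have dim: "dim_vec (b i) = n" if "i < n" for i using b that by (auto simp: orthonormal_basis_def)
  define U where "U = mat n n (\<lambda>(r, i). b i $ r)"
  have Uc: "U \<in> square_mats n" by (simp add: U_def)
  have "mat_adjoint U * U = 1\<^sub>m n"
  proof (rule eq_matI)
    fix i j assume "i < dim_row (1\<^sub>m n :: complex mat)" "j < dim_col (1\<^sub>m n :: complex mat)"
    hence ij: "i < n" "j < n" by auto
    have "(mat_adjoint U * U) $$ (i, j) = b j \<bullet>c b i"
      using ij by (simp add: index_mult_mat_sum U_def cscalar_prod_sum dim mult.commute del: index_mult_mat(1))
    thus "(mat_adjoint U * U) $$ (i, j) = 1\<^sub>m n $$ (i, j)"
      using b ij by (auto simp: orthonormal_basis_def)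
  qed (auto simp: U_def)
  hence "unitary n U" using Uc by (simp add: unitary_def)
  moreover have "P X = measure_in n U X" if X: "X \<in> square_mats n" for X
  proof (rule eq_matI)
    have MU: "measure_in n U X \<in> square_mats n" using Uc by (auto simp: measure_in_def)
    fix r c assume "r < dim_row (measure_in n U X)" "c < dim_col (measure_in n U X)"
    hence rc: "r < n" "c < n" using MU by auto
    have "measure_in n U X $$ (r, c) = (\<Sum>i<n. U $$ (r, i) * (mat_adjoint U * X * U) $$ (i, i) * cnj (U $$ (c, i)))"
      unfolding measure_in_def by (rule index_mult_diag_adjoint[OF Uc rc])
    also have "\<dots> = (\<Sum>i<n. (ket_bra (b i) * X * ket_bra (b i)) $$ (r, c))"
    proof (rule sum.cong[OF refl])
      fix i assume "i \<in> {..<n}"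
      hence i: "i < n" by simp
      have "(mat_adjoint U * X * U) $$ (i, i) = (\<Sum>l<n. (\<Sum>k<n. cnj (b i $ k) * X $$ (k, l)) * b i $ l)"
        using i X by (simp add: index_mult_mat_sum U_def del: index_mult_mat(1))
      moreover have "(ket_bra (b i) * X * ket_bra (b i)) $$ (r, c)
          = (\<Sum>l<n. (\<Sum>k<n. b i $ r * cnj (b i $ k) * X $$ (k, l)) * (b i $ l * cnj (b i $ c)))"
        using i rc X by (simp add: index_mult_mat_sum ket_bra_def dim del: index_mult_mat(1))
      ultimately show "U $$ (r, i) * (mat_adjoint U * X * U) $$ (i, i) * cnj (U $$ (c, i))
          = (ket_bra (b i) * X * ket_bra (b i)) $$ (r, c)"
        using i rc by (simp add: U_def sum_distrib_left sum_distrib_right mult_ac)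
    qed
    finally show "P X $$ (r, c) = measure_in n U X $$ (r, c)"
      using rc by (simp add: P mat_sum_def)
  qed (use Uc in \<open>auto simp: P mat_sum_def measure_in_def\<close>)
  ultimately show ?thesis by (rule that)
qed

lemma rank_one_measurement_exists: "\<exists>P. rank_one_measurement n P"
proof -
  have "orthonormal_basis n (unit_vec n)"
    by (auto simp: orthonormal_basis_def cscalar_prod_sum if_distrib cong: if_cong)
  thus ?thesis by (auto simp: rank_one_measurement_def)
qed

lemma linear_map_measure_in:
  assumes U: "U \<in> square_mats n"
  shows "linear_map n (measure_in n U)"
proof -
  have "linear_map n (\<lambda>X. mat_diag n (\<lambda>i. X $$ (i, i)))"
    unfolding linear_map_def by (auto intro!: eq_matI)
  from linear_map_comp[OF linear_map_congruence[OF U mat_adjoint_carrier[OF U]]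
      linear_map_comp[OF this linear_map_congruence[OF mat_adjoint_carrier[OF U] U]]]
  show ?thesis by (simp add: measure_in_def[abs_def])
qed

text \<open>Only values at matrix units enter the definition, so a measurement may be replaced by
  its \<open>measure_in\<close> form although their agreement is known on one matrix size
  only.\<close>

lemma map_tensor_cong:
  assumes "\<And>A. A \<in> square_mats m \<Longrightarrow> \<Phi> A = \<Phi>' A" "\<And>B. B \<in> square_mats n \<Longrightarrow> \<Psi> B = \<Psi>' B"
  shows "map_tensor m n \<Phi> \<Psi> X = map_tensor m n \<Phi>' \<Psi>' X"
  by (simp add: map_tensor_def assms)

text \<open>On a product operator the diagonal of a Kronecker product is the Kronecker product of
  the diagonals, and the rotations combine by the mixed-product rule.\<close>

lemma map_tensor_measure_in:
  assumes U: "unitary m U" and V: "unitary n V" and X: "X \<in> square_mats (m * n)"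
  shows "map_tensor m n (measure_in m U) (measure_in n V) X = measure_in (m * n) (kron U V) X"
proof (rule linear_map_eq_on_kron[OF linear_map_map_tensor _ _ X])
  note c = unitary_carrier[OF U] unitary_carrier[OF V]
  show "linear_map (m * n) (measure_in (m * n) (kron U V))"
    by (intro linear_map_measure_in unitary_carrier unitary_kron U V)
  fix A B :: "complex mat" assume AB: "A \<in> square_mats m" "B \<in> square_mats n"
  let ?A = "mat_adjoint U * A * U" and ?B = "mat_adjoint V * B * V"
  have d: "dim_row ?A = m" "dim_col ?A = m" "dim_row ?B = n" "dim_col ?B = n"
    using c by auto
  have "kron (mat_diag m (\<lambda>i. ?A $$ (i, i))) (mat_diag n (\<lambda>i. ?B $$ (i, i)))
      = mat_diag (m * n) (\<lambda>i. kron ?A ?B $$ (i, i))" (is "?L = ?R")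
  proof (rule eq_matI)
    fix x y assume "x < dim_row ?R" "y < dim_col ?R"
    thus "?L $$ (x, y) = ?R $$ (x, y)"
      using div_mod_less[of x m n] div_mod_less[of y m n]
      by (auto simp: index_kron unitary_dim[OF U] unitary_dim[OF V] simp del: index_mult_mat(1) dest: div_mod_inject)
  qed auto
  moreover have "kron ?A ?B = mat_adjoint (kron U V) * kron A B * kron U V"
    using c AB by (simp add: mat_adjoint_kron kron_mult[of _ m m _ m _ n n _ n]
        mult_carrier_mat[of _ m m] mult_carrier_mat[of _ n n])
  ultimately have "measure_in (m * n) (kron U V) (kron A B)
      = kron U V * kron (mat_diag m (\<lambda>i. ?A $$ (i, i))) (mat_diag n (\<lambda>i. ?B $$ (i, i))) * mat_adjoint (kron U V)"
    by (simp add: measure_in_def)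
  also have "\<dots> = kron (measure_in m U A) (measure_in n V B)"
    using c by (simp add: measure_in_def mat_adjoint_kron kron_mult[of _ m m _ m _ n n _ n])
  also have "\<dots> = map_tensor m n (measure_in m U) (measure_in n V) (kron A B)"
    using c AB by (simp add: map_tensor_kron linear_map_measure_in)
  finally show "map_tensor m n (measure_in m U) (measure_in n V) (kron A B)
      = measure_in (m * n) (kron U V) (kron A B)" ..
qed

text \<open>The measured operator is a combination of product states with the diagonal entries of
  \<open>X\<close> in the measurement basis as coefficients; a positive trace-preserving map sends product
  states to product states, so the norm is at most the sum of the moduli of these entries.\<close>

lemma trace_norm_map_tensor_measured_le:
  assumes W: "positive_map m W" "trace_preserving m W" and W': "positive_map n W'" "trace_preserving n W'"
    and U: "unitary m U" and V: "unitary n V" and X: "X \<in> square_mats (m * n)"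
  shows "trace_norm (map_tensor m n W W' (measure_in (m * n) (kron U V) X)) \<le> trace_norm X"
proof -
  let ?N = "m * n" and ?K = "kron U V" and ?T = "map_tensor m n W W'"
  have lin: "linear_map m W" "linear_map n W'" using W W' by (auto simp: positive_map_def)
  have K: "unitary ?N ?K" by (rule unitary_kron[OF U V])
  note Kc = unitary_carrier[OF K] and Uc = unitary_carrier[OF U] and Vc = unitary_carrier[OF V]
  \<comment> \<open>For a state these would be outcome probabilities. \<open>X\<close> is arbitrary
    here, so they are complex numbers and their moduli are summed.\<close>
  define p where "p i = (mat_adjoint ?K * X * ?K) $$ (i, i)" for i
  \<comment> \<open>The projector onto column \<open>i\<close> of a unitary, with size and unitary
    as parameters because both factors use it.\<close>
  define e where "e k i U = U * mat_unit k i i * mat_adjoint U" for k i and U :: "complex mat"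
  have ec: "e k i Q \<in> square_mats k" if "unitary k Q" for k i Q
    using unitary_carrier[OF that] by (auto simp: e_def)
  have e_psd: "psd k (e k i Q)" and e_tr: "mat_trace (e k i Q) = 1" if Q: "unitary k Q" "i < k" for k i Q
  proof -
    have "mat_unit k i i = mat_diag k (\<lambda>j. complex_of_real (if j = i then 1 else 0))"
      by (intro eq_matI) (auto simp: mat_unit_def)
    hence "psd k (mat_unit k i i)" using psd_diag[of k "\<lambda>j. if j = i then 1 else 0"] by simp
    thus "psd k (e k i Q)" unfolding e_def by (rule psd_congruence) (rule unitary_carrier[OF Q(1)])
    have "mat_trace (mat_unit k i i) = 1" using Q by (simp add: mat_trace_def mat_unit_def)
    thus "mat_trace (e k i Q) = 1" unfolding e_def using Q by (simp add: mat_trace_unitary)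
  qed
  have "measure_in ?N ?K X = ?K * mat_sum ?N (\<lambda>i. p i \<cdot>\<^sub>m mat_unit ?N i i) {..<?N} * mat_adjoint ?K"
  proof -
    have "mat_diag ?N p = mat_sum ?N (\<lambda>i. p i \<cdot>\<^sub>m mat_unit ?N i i) {..<?N}"
    proof (rule eq_matI)
      fix r c assume "r < dim_row (mat_sum ?N (\<lambda>i. p i \<cdot>\<^sub>m mat_unit ?N i i) {..<?N})"
        "c < dim_col (mat_sum ?N (\<lambda>i. p i \<cdot>\<^sub>m mat_unit ?N i i) {..<?N})"
      hence rc: "r < ?N" "c < ?N" by (auto simp: mat_sum_def)
      have "(\<Sum>i<?N. (p i \<cdot>\<^sub>m mat_unit ?N i i) $$ (r, c)) = (\<Sum>i<?N. if i = r then if r = c then p r else 0 else 0)"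
        using rc by (intro sum.cong refl) (auto simp: mat_unit_def)
      thus "mat_diag ?N p $$ (r, c) = mat_sum ?N (\<lambda>i. p i \<cdot>\<^sub>m mat_unit ?N i i) {..<?N} $$ (r, c)"
        using rc by (auto simp: mat_sum_def)
    qed (auto simp: mat_sum_def)
    thus ?thesis by (simp add: measure_in_def p_def[abs_def])
  qed
  also have "\<dots> = mat_sum ?N (\<lambda>i. ?K * (p i \<cdot>\<^sub>m mat_unit ?N i i) * mat_adjoint ?K) {..<?N}"
    by (rule linear_map_mat_sum[OF linear_map_congruence[OF Kc mat_adjoint_carrier[OF Kc]]]) auto
  also have "\<dots> = mat_sum ?N (\<lambda>i. p i \<cdot>\<^sub>m kron (e m (i div n) U) (e n (i mod n) V)) {..<?N}"
  proof (rule mat_sum_cong)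
    fix i assume "i \<in> {..<?N}"
    hence i: "i < ?N" by simp
    have "?K * (p i \<cdot>\<^sub>m mat_unit ?N i i) * mat_adjoint ?K = p i \<cdot>\<^sub>m (?K * mat_unit ?N i i * mat_adjoint ?K)"
      using linear_map_smult[OF linear_map_congruence[OF Kc mat_adjoint_carrier[OF Kc]], of "mat_unit ?N i i" "p i"]
      by simp
    also have "?K * mat_unit ?N i i * mat_adjoint ?K = kron (e m (i div n) U) (e n (i mod n) V)"
      using Uc Vc unfolding kron_mat_unit[OF i i, symmetric] e_def
      by (simp add: mat_adjoint_kron kron_mult[of _ m m _ m _ n n _ n])
    finally show "?K * (p i \<cdot>\<^sub>m mat_unit ?N i i) * mat_adjoint ?K
        = p i \<cdot>\<^sub>m kron (e m (i div n) U) (e n (i mod n) V)" .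
  qed
  finally have M: "measure_in ?N ?K X = mat_sum ?N (\<lambda>i. p i \<cdot>\<^sub>m kron (e m (i div n) U) (e n (i mod n) V)) {..<?N}" .
  have kc: "kron (e m i U) (e n j V) \<in> square_mats ?N" for i j
    using ec[OF U] ec[OF V] by simp
  have Tk: "?T (p i \<cdot>\<^sub>m kron (e m (i div n) U) (e n (i mod n) V))
      = p i \<cdot>\<^sub>m kron (W (e m (i div n) U)) (W' (e n (i mod n) V))" for i
    using kc by (simp add: linear_map_smult[OF linear_map_map_tensor] map_tensor_kron[OF lin ec[OF U] ec[OF V]])
  have Wc: "kron (W (e m i U)) (W' (e n j V)) \<in> square_mats ?N" for i j
    using linear_map_carrier[OF lin(1) ec[OF U]] linear_map_carrier[OF lin(2) ec[OF V]] by simp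
  have "?T (measure_in ?N ?K X)
      = mat_sum ?N (\<lambda>i. p i \<cdot>\<^sub>m kron (W (e m (i div n) U)) (W' (e n (i mod n) V))) {..<?N}"
    unfolding M using kc
    by (subst linear_map_mat_sum[OF linear_map_map_tensor]) (auto simp: Tk)
  also have "trace_norm \<dots> \<le> (\<Sum>i<?N. trace_norm (p i \<cdot>\<^sub>m kron (W (e m (i div n) U)) (W' (e n (i mod n) V))))"
    using Wc by (intro trace_norm_mat_sum_le) auto
  also have "\<dots> \<le> (\<Sum>i<?N. cmod (p i))"
  proof (rule sum_mono)
    fix i assume "i \<in> {..<?N}"
    hence i: "i div n < m" "i mod n < n" using div_mod_less[of i m n] by auto
    let ?k = "kron (W (e m (i div n) U)) (W' (e n (i mod n) V))"
    have "psd ?N ?k"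
      using W W' e_psd[OF U i(1)] e_psd[OF V i(2)] by (intro psd_kron) (auto simp: positive_map_def)
    moreover have "mat_trace ?k = 1"
      using W(2) W'(2) ec[OF U] ec[OF V] e_tr[OF U i(1)] e_tr[OF V i(2)]
        linear_map_carrier[OF lin(1) ec[OF U]] linear_map_carrier[OF lin(2) ec[OF V]]
      by (simp add: mat_trace_kron[of _ m _ n] trace_preserving_def)
    ultimately have "trace_norm ?k = 1" by (simp add: trace_norm_psd)
    thus "trace_norm (p i \<cdot>\<^sub>m ?k) \<le> cmod (p i)"
      using trace_norm_smult_le[OF Wc, of "p i" "i div n" "i mod n"] by simp
  qed
  also have "\<dots> \<le> trace_norm (mat_adjoint ?K * X * ?K)"
    unfolding p_def by (rule trace_norm_ge_diag) (rule mult_carrier_mat[OF mult_carrier_mat[OF mat_adjoint_carrier[OF Kc] X] Kc])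
  also have "\<dots> \<le> trace_norm X"
    using trace_norm_unitary_le[OF X unitary_adjoint[OF K]] by simp
  finally show ?thesis .
qed

subsection \<open>The bound on the Helstrom distinguishability\<close>

text \<open>Complete positivity enters here: \<open>\<Phi> \<otimes> \<Phi>\<close> is
  \<open>\<Phi> \<otimes> id\<close> after \<open>id \<otimes> \<Phi>\<close>, and the flip reduces
  the second to the first. The evolved pair is thus a genuine ensemble.\<close>

lemma density_map_tensor:
  assumes "cptp d \<Phi>" "density (d * d) \<rho>"
  shows "density (d * d) (map_tensor d d \<Phi> \<Phi> \<rho>)"
proof -
  have \<Phi>: "linear_map d \<Phi>" "trace_preserving d \<Phi>" and pos: "positive_map (d * d) (map_tensor d d \<Phi> id)"
    using assms(1) by (auto simp: cptp_def completely_positive_def)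
  have \<rho>: "psd (d * d) \<rho>" and \<rho>c: "\<rho> \<in> square_mats (d * d)" and tr: "mat_trace \<rho> = 1"
    using assms(2) by (auto simp: density_def psd_def)
  let ?S = "swap_mat d"
  have "psd (d * d) (map_tensor d d \<Phi> id (?S * \<rho> * mat_adjoint ?S))"
    using pos psd_congruence[OF \<rho> swap_mat_carrier] by (auto simp: positive_map_def)
  hence "psd (d * d) (map_tensor d d id \<Phi> \<rho>)"
    unfolding map_tensor_id_swap[OF \<Phi>(1) \<rho>c] by (rule psd_congruence[OF _ swap_mat_carrier])
  hence "psd (d * d) (map_tensor d d \<Phi> id (map_tensor d d id \<Phi> \<rho>))"
    using pos by (simp add: positive_map_def)
  also have "map_tensor d d \<Phi> id (map_tensor d d id \<Phi> \<rho>) = map_tensor d d \<Phi> \<Phi> \<rho>"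
    using \<Phi>(1) linear_map_id \<rho>c by (intro map_tensor_comp) auto
  finally show ?thesis
    using map_tensor_trace[OF \<Phi>(1) \<Phi>(1) \<Phi>(2) \<Phi>(2) \<rho>c] tr by (simp add: density_def)
qed

text \<open>The measurement is fixed and \<open>X\<close> is any operator; weights and states enter
  only afterwards, when \<open>X\<close> is split.\<close>

lemma trace_norm_increase_le:
  assumes W: "positive_map d W" "trace_preserving d W"
    and P: "rank_one_measurement d P" "rank_one_measurement d Q"
    and X: "X \<in> square_mats (d * d)"
  shows "trace_norm (map_tensor d d W W X) - trace_norm X
    \<le> (diamond_norm d W)\<^sup>2 * trace_norm (X - map_tensor d d P Q X)"
proof -
  have lin: "linear_map d W" using W by (simp add: positive_map_def)
  obtain U V where U: "unitary d U" "\<And>A. A \<in> square_mats d \<Longrightarrow> P A = measure_in d U A"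
    and V: "unitary d V" "\<And>A. A \<in> square_mats d \<Longrightarrow> Q A = measure_in d V A"
    using P by (metis rank_one_measurementE)
  let ?M = "map_tensor d d P Q X" and ?T = "map_tensor d d W W"
  have M: "?M = measure_in (d * d) (kron U V) X"
    using map_tensor_cong[OF U(2) V(2)] map_tensor_measure_in[OF U(1) V(1) X] by simp
  have Mc: "?M \<in> square_mats (d * d)" by (rule linear_map_carrier[OF linear_map_map_tensor X])
  have "X = (X - ?M) + ?M" using X Mc by (intro eq_matI) auto
  hence "?T X = ?T (X - ?M) + ?T ?M"
    using linear_map_add[OF linear_map_map_tensor, of "X - ?M" d d ?M W W] minus_carrier_mat[OF Mc] Mc by simp
  hence "trace_norm (?T X) \<le> trace_norm (?T (X - ?M)) + trace_norm (?T ?M)"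
    using trace_norm_triangle[of "?T (X - ?M)" "d * d" "?T ?M"]
      linear_map_carrier[OF linear_map_map_tensor minus_carrier_mat[OF Mc]]
      linear_map_carrier[OF linear_map_map_tensor Mc] by simp
  also have "trace_norm (?T ?M) \<le> trace_norm X"
    unfolding M by (rule trace_norm_map_tensor_measured_le[OF W W U(1) V(1) X])
  also have "trace_norm (?T (X - ?M)) \<le> (diamond_norm d W)\<^sup>2 * trace_norm (X - ?M)"
    using X Mc by (intro trace_norm_map_tensor_le lin) auto
  finally show ?thesis by simp
qed

theorem proposition4:
  fixes d :: nat
    and \<Lambda> :: "real \<Rightarrow> complex mat \<Rightarrow> complex mat"
    and V :: "real \<Rightarrow> real \<Rightarrow> complex mat \<Rightarrow> complex mat"
    and \<rho> \<sigma> :: "complex mat"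
    and \<mu> t \<tau> :: real
  assumes "\<And>s. 0 \<le> s \<Longrightarrow> cptp d (\<Lambda> s)"
    and "P_divisible_with d \<Lambda> V"
    and "density (d * d) \<rho>"
    and "density (d * d) \<sigma>"
    and "0 \<le> \<mu>" and "\<mu> \<le> 1"
    and "0 < t" and "0 < \<tau>"
  shows "let \<Delta> = complex_of_real \<mu> \<cdot>\<^sub>m \<rho> - complex_of_real (1 - \<mu>) \<cdot>\<^sub>m \<sigma>;
             \<rho>t = map_tensor d d (\<Lambda> t) (\<Lambda> t) \<rho>;
             \<sigma>t = map_tensor d d (\<Lambda> t) (\<Lambda> t) \<sigma>;
             \<chi> = complex_of_real \<mu> \<cdot>\<^sub>m kron \<rho>t (ket_bra (unit_vec 2 0))
               + complex_of_real (1 - \<mu>) \<cdot>\<^sub>m kron \<sigma>t (ket_bra (unit_vec 2 1))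
         in trace_norm (map_tensor d d (\<Lambda> (t + \<tau>)) (\<Lambda> (t + \<tau>)) \<Delta>)
              - trace_norm (map_tensor d d (\<Lambda> t) (\<Lambda> t) \<Delta>)
            \<le> 2 * (diamond_norm d (V (t + \<tau>) t))\<^sup>2 * ensemble_quantumness d d \<chi>"
proof -
  define W where "W = V (t + \<tau>) t"
  let ?N = "d * d" and ?c = "(diamond_norm d W)\<^sup>2"
  let ?T = "map_tensor d d (\<Lambda> t) (\<Lambda> t)"
  define \<Delta> where "\<Delta> = complex_of_real \<mu> \<cdot>\<^sub>m \<rho> - complex_of_real (1 - \<mu>) \<cdot>\<^sub>m \<sigma>"
  define R where "R = ?T \<rho>"
  define S where "S = ?T \<sigma>"
  define E where "E = [(\<mu>, R), (1 - \<mu>, S)]"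
  have W: "positive_map d W" "trace_preserving d W" "\<And>X. X \<in> square_mats d \<Longrightarrow> \<Lambda> (t + \<tau>) X = W (\<Lambda> t X)"
    using assms(2,7,8) by (auto simp: P_divisible_with_def W_def)
  have c: "\<rho> \<in> square_mats ?N" "\<sigma> \<in> square_mats ?N"
    using assms(3,4) by (auto simp: density_def psd_def)
  have cp: "cptp d (\<Lambda> t)" "cptp d (\<Lambda> (t + \<tau>))" using assms(1,7,8) by auto
  hence lin: "linear_map d (\<Lambda> t)" "linear_map d (\<Lambda> (t + \<tau>))"
    by (auto simp: cptp_def completely_positive_def)
  have RS: "density ?N R" "density ?N S"
    unfolding R_def S_def by (intro density_map_tensor cp assms)+
  hence RSc: "R \<in> square_mats ?N" "S \<in> square_mats ?N" by (auto simp: density_def psd_def)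
  define X where "X = ?T \<Delta>"
  \<comment> \<open>Rewriting the difference as a sum with coefficient \<mu> - 1 lets additivity and
    homogeneity of the maps apply directly.\<close>
  have sub: "complex_of_real \<mu> \<cdot>\<^sub>m A - complex_of_real (1 - \<mu>) \<cdot>\<^sub>m B
      = complex_of_real \<mu> \<cdot>\<^sub>m A + complex_of_real (\<mu> - 1) \<cdot>\<^sub>m B"
    if "A \<in> square_mats ?N" "B \<in> square_mats ?N" for A B
    using that by (intro eq_matI) (auto simp: algebra_simps)
  have X: "X = complex_of_real \<mu> \<cdot>\<^sub>m R + complex_of_real (\<mu> - 1) \<cdot>\<^sub>m S"
    unfolding X_def \<Delta>_def sub[OF c] R_def S_def
    using c by (simp add: linear_map_add[OF linear_map_map_tensor] linear_map_smult[OF linear_map_map_tensor])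
  have Xc: "X \<in> square_mats ?N" unfolding X using RSc by simp
  have \<Delta>c: "\<Delta> \<in> square_mats ?N" unfolding \<Delta>_def using c by (intro minus_carrier_mat) simp
  have WX: "map_tensor d d (\<Lambda> (t + \<tau>)) (\<Lambda> (t + \<tau>)) \<Delta> = map_tensor d d W W X"
    unfolding X_def using W lin \<Delta>c
    by (intro map_tensor_comp[symmetric]) (auto simp: positive_map_def)
  have bound: "trace_norm (map_tensor d d W W X) - trace_norm X
      \<le> 2 * ?c * (\<mu> * trace_distance R (map_tensor d d P Q R) + (1 - \<mu>) * trace_distance S (map_tensor d d P Q S))"
    if P: "rank_one_measurement d P" "rank_one_measurement d Q" for P Q
  proof -
    let ?P = "map_tensor d d P Q"
    have Pc: "?P R \<in> square_mats ?N" "?P S \<in> square_mats ?N"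
      using RSc by (auto intro!: linear_map_carrier[OF linear_map_map_tensor])
    have "?P X = complex_of_real \<mu> \<cdot>\<^sub>m ?P R + complex_of_real (\<mu> - 1) \<cdot>\<^sub>m ?P S"
      unfolding X using RSc
      by (simp add: linear_map_add[OF linear_map_map_tensor] linear_map_smult[OF linear_map_map_tensor])
    hence "X - ?P X = complex_of_real \<mu> \<cdot>\<^sub>m (R - ?P R) + complex_of_real (\<mu> - 1) \<cdot>\<^sub>m (S - ?P S)"
      unfolding X using RSc Pc by (intro eq_matI) (auto simp: algebra_simps)
    hence "trace_norm (X - ?P X)
        \<le> trace_norm (complex_of_real \<mu> \<cdot>\<^sub>m (R - ?P R)) + trace_norm (complex_of_real (\<mu> - 1) \<cdot>\<^sub>m (S - ?P S))"
      using RSc Pc by (simp add: trace_norm_triangle[of _ ?N] minus_carrier_mat)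
    also have "\<dots> \<le> \<mu> * trace_norm (R - ?P R) + (1 - \<mu>) * trace_norm (S - ?P S)"
    proof (rule add_mono)
      show "trace_norm (complex_of_real \<mu> \<cdot>\<^sub>m (R - ?P R)) \<le> \<mu> * trace_norm (R - ?P R)"
        using trace_norm_smult_le[OF minus_carrier_mat[OF Pc(1)], of "complex_of_real \<mu>" R] assms(5) by simp
      show "trace_norm (complex_of_real (\<mu> - 1) \<cdot>\<^sub>m (S - ?P S)) \<le> (1 - \<mu>) * trace_norm (S - ?P S)"
        using trace_norm_smult_le[OF minus_carrier_mat[OF Pc(2)], of "complex_of_real (\<mu> - 1)" S] assms(6)
        by (simp only: norm_of_real) simp
    qed
    finally have "?c * trace_norm (X - ?P X) \<le> ?c * (\<mu> * trace_norm (R - ?P R) + (1 - \<mu>) * trace_norm (S - ?P S))"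
      by (rule mult_left_mono) simp
    \<comment> \<open>The factor 2 turns trace distances back into trace norms.\<close>
    moreover have "2 * ?c * (\<mu> * trace_distance R (?P R) + (1 - \<mu>) * trace_distance S (?P S))
        = ?c * (\<mu> * trace_norm (R - ?P R) + (1 - \<mu>) * trace_norm (S - ?P S))"
      by (simp add: trace_distance_def field_simps)
    ultimately show ?thesis using trace_norm_increase_le[OF W(1,2) P Xc] by linarith
  qed
  let ?D = "trace_norm (map_tensor d d W W X) - trace_norm X"
  have ens: "ensemble ?N E" using RS assms(5,6) by (auto simp: ensemble_def E_def)
  have "?D \<le> 2 * ?c * min_disturbance d d E"
  proof (cases "?c = 0")
    case True
    \<comment> \<open>The constant cannot be divided out here, but the bound for one arbitrary pair
      already makes the increase at most 0, which is the value of the right-hand side.\<close>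
    obtain P where "rank_one_measurement d P" using rank_one_measurement_exists by blast
    thus ?thesis using bound[of P P] True by simp
  next
    case False
    hence c0: "0 < 2 * ?c" by simp
    \<comment> \<open>After division the left side is a lower bound of the set of disturbances and
      hence of its infimum; existence of a measurement makes that set nonempty.\<close>
    have "?D / (2 * ?c) \<le> min_disturbance d d E"
      unfolding min_disturbance_def
    proof (rule cInf_greatest)
      fix x assume "x \<in> {\<Sum>i<length E. fst (E ! i) *
            trace_distance (snd (E ! i)) (map_tensor d d P1 P2 (snd (E ! i))) | P1 P2.
          rank_one_measurement d P1 \<and> rank_one_measurement d P2}"
      then obtain P Q where P: "rank_one_measurement d P" "rank_one_measurement d Q"
        and x: "x = (\<Sum>i<length E. fst (E ! i) * trace_distance (snd (E ! i)) (map_tensor d d P Q (snd (E ! i))))"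
        by blast
      have "x = \<mu> * trace_distance R (map_tensor d d P Q R) + (1 - \<mu>) * trace_distance S (map_tensor d d P Q S)"
        unfolding x by (simp add: E_def numeral_2_eq_2)
      thus "?D / (2 * ?c) \<le> x"
        using bound[OF P] c0 by (simp add: pos_divide_le_eq mult.commute)
    qed (use rank_one_measurement_exists[of d] in blast)
    thus ?thesis using c0 by (simp add: pos_divide_le_eq mult.commute)
  qed
  \<comment> \<open>\<open>ensemble_quantumness\<close> is a definite description over ensembles
    with the given encoding; \<open>ens\<close> is what allows it to be evaluated.\<close>
  also have "min_disturbance d d E = ensemble_quantumness d d (encode ?N E)"
    by (rule ensemble_quantumness_encode[OF ens, symmetric])
  also have "encode ?N E = complex_of_real \<mu> \<cdot>\<^sub>m kron R (ket_bra (unit_vec 2 0))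
               + complex_of_real (1 - \<mu>) \<cdot>\<^sub>m kron S (ket_bra (unit_vec 2 1))"
    unfolding E_def by (rule encode_pair[OF RSc])
  finally show ?thesis
    unfolding WX[symmetric] unfolding Let_def X_def \<Delta>_def R_def S_def W_def .
qed

end
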